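(* There is a constant $c>0$ such that for every integer $b\ge2$, every positive integer $w<b(\log b)^{3/2}$, and every point $o=(x_o,y_o)$ with $x_o,y_o\ge\delta$, with probability at least $1-\frac{c}{(\log b)^{3/2}}$ the random graph $\hat{\mathcal H}_{w,b}$ has a connected dominating set consisting of two blue vertices lying in $D_\delta(o)$; that is, there exist two blue points $u,v\in D_\delta(o)$ with $d(u,v)\le1$ such that every one of the $w+b$ points is at distance at most $1$ from $u$ or from $v$.
   Context: $\mathbb{R}_+^2=\{(x,y):x\ge0,y\ge0\}$; $D_r(p)$ is the closed disk of radius $r$ centered at $p$, $d$ is Euclidean distance, and $\hat D_1(o)=D_1(o)\cap\mathbb{R}_+^2$. Let $\delta=\frac{1}{b^{1/3}\log b}$. Select $w+b$ points independently and uniformly at random from $\hat D_1(o)$; color the first $w$ white and the remaining $b$ blue. $\hat{\mathcal H}_{w,b}$ is the graph on these $w+b$ points with an edge between two points iff their distance is at most $1$. A connected dominating set is a set $S$ of vertices such that every vertex is in $S$ or adjacent to a vertex of $S$, and the subgraph induced by $S$ is connected. *)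

theory Defs
  imports "HOL-Probability.Probability" "Graph_Theory.Digraph_Component"
begin

definition quadrant :: "(real \<times> real) set" where
  "quadrant = {(x, y). 0 \<le> x \<and> 0 \<le> y}"

definition disk_hat :: "real \<times> real \<Rightarrow> (real \<times> real) set" where
  "disk_hat p = cball p 1 \<inter> quadrant"

definition delta :: "nat \<Rightarrow> real" where
  "delta b = 1 / (real b powr (1/3) * ln (real b))"

text \<open>The sample space of \<open>n\<close> independent uniform points; a sample is the map
  sending the index \<open>i < n\<close> to the \<open>i\<close>-th point.\<close>

definition uniform_points :: "nat \<Rightarrow> real \<times> real \<Rightarrow> (nat \<Rightarrow> real \<times> real) measure" where
  "uniform_points n p = (\<Pi>\<^sub>M i\<in>{..<n}. uniform_measure lborel (disk_hat p))"

text \<open>The vertices are the indices of the points, so coinciding points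
  (an event of probability zero) would still be different vertices.
  As usual in this library, an undirected graph is a symmetric digraph.\<close>

definition unit_disk_graph :: "nat \<Rightarrow> (nat \<Rightarrow> real \<times> real) \<Rightarrow> nat pair_pre_digraph" where
  "unit_disk_graph n X = \<lparr> pverts = {..<n},
     parcs = {(i, j). i < n \<and> j < n \<and> i \<noteq> j \<and> dist (X i) (X j) \<le> 1} \<rparr>"

definition blue :: "nat \<Rightarrow> nat \<Rightarrow> nat set" where
  "blue w b = {w..<w + b}"

definition connected_dominating_set :: "('a, 'b) pre_digraph \<Rightarrow> 'a set \<Rightarrow> bool" where
  "connected_dominating_set G S \<longleftrightarrow>
     S \<subseteq> verts G \<and>
     (\<forall>x\<in>verts G. x \<in> S \<or> (\<exists>y\<in>S. x \<rightarrow>\<^bsub>G\<^esub> y)) \<and>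
     Digraph_Component.connected (G \<restriction> S)"

lemma unit_disk_graph_adj:
  "i \<rightarrow>\<^bsub>with_proj (unit_disk_graph n X)\<^esub> j \<longleftrightarrow>
     i < n \<and> j < n \<and> i \<noteq> j \<and> dist (X i) (X j) \<le> 1"
  by (auto simp: unit_disk_graph_def arcs_ends_conv with_proj_def image_iff)

lemma graph_unit_disk_graph: "graph (with_proj (unit_disk_graph n X))"
proof -
  have "finite {(i, j). i < n \<and> j < n \<and> i \<noteq> j \<and> dist (X i) (X j) \<le> 1}"
    by (rule finite_subset[of _ "{..<n} \<times> {..<n}"]) auto
  then show ?thesis
    by unfold_locales
      (auto simp: unit_disk_graph_def with_proj_def arc_to_ends_def symmetric_conv dist_commute)
qed

text \<open>For two vertices, being a connected dominating set means exactly that the two points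
  are at distance at most 1 and every point is at distance at most 1 from one of them.\<close>

lemma connected_dominating_pair_iff:
  assumes "u < n" "v < n" "u \<noteq> v"
  shows "connected_dominating_set (with_proj (unit_disk_graph n X)) {u, v} \<longleftrightarrow>
     dist (X u) (X v) \<le> 1 \<and> (\<forall>i<n. dist (X i) (X u) \<le> 1 \<or> dist (X i) (X v) \<le> 1)"
proof -
  let ?G = "with_proj (unit_disk_graph n X)"
  let ?H = "with_proj (mk_symmetric (?G \<restriction> {u, v}))"
  have vG: "verts ?G = {..<n}" by (simp add: unit_disk_graph_def)
  have vH: "verts ?H = {u, v}" by (simp add: mk_symmetric_def)
  have adjH: "x \<rightarrow>\<^bsub>?H\<^esub> y \<longleftrightarrow> x \<in> {u, v} \<and> y \<in> {u, v} \<and> x \<noteq> y \<and> dist (X x) (X y) \<le> 1" for x y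
    using assms
    by (auto simp: mk_symmetric_def induce_subgraph_def unit_disk_graph_def arcs_ends_conv
        with_proj_def image_iff dist_commute)
  interpret H: wf_digraph ?H
    by unfold_locales (auto simp: mk_symmetric_def)
  have conn: "Digraph_Component.connected (?G \<restriction> {u, v}) \<longleftrightarrow> dist (X u) (X v) \<le> 1"
  proof
    assume "Digraph_Component.connected (?G \<restriction> {u, v})"
    then have "u \<rightarrow>\<^sup>*\<^bsub>?H\<^esub> v"
      unfolding Digraph_Component.connected_def strongly_connected_def vH by blast
    then obtain y where "u \<rightarrow>\<^bsub>?H\<^esub> y"
      using \<open>u \<noteq> v\<close> by (cases rule: H.converse_reachable_cases) auto
    then show "dist (X u) (X v) \<le> 1" unfolding adjH by (auto simp: dist_commute)
  next
    assume d: "dist (X u) (X v) \<le> 1"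
    then have "u \<rightarrow>\<^bsub>?H\<^esub> v" "v \<rightarrow>\<^bsub>?H\<^esub> u"
      unfolding adjH using assms by (auto simp: dist_commute)
    then have "u \<rightarrow>\<^sup>*\<^bsub>?H\<^esub> v" "v \<rightarrow>\<^sup>*\<^bsub>?H\<^esub> u" by auto
    moreover have "u \<rightarrow>\<^sup>*\<^bsub>?H\<^esub> u" "v \<rightarrow>\<^sup>*\<^bsub>?H\<^esub> v"
      using vH by (auto intro: H.reachable_refl)
    ultimately show "Digraph_Component.connected (?G \<restriction> {u, v})"
      unfolding Digraph_Component.connected_def strongly_connected_def vH by blast
  qed
  have dom: "(\<forall>x\<in>verts ?G. x \<in> {u, v} \<or> (\<exists>y\<in>{u, v}. x \<rightarrow>\<^bsub>?G\<^esub> y)) \<longleftrightarrow>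
      (\<forall>i<n. dist (X i) (X u) \<le> 1 \<or> dist (X i) (X v) \<le> 1)"
    unfolding vG unit_disk_graph_adj using assms by (auto; metis dist_self lessThan_iff zero_le_one)
  show ?thesis
    unfolding connected_dominating_set_def conn dom using assms vG by auto
qed

end

theory Submission
  imports Defs "HOL-Real_Asymp.Real_Asymp"
begin

text \<open>Put the origin at \<open>o\<close> and write \<open>d\<close> for \<open>\<delta>\<close>. If two points of \<open>D\<^sub>d(o)\<close> lie in opposite
  directions up to an angle of order \<open>d\<close>, at distance of order \<open>d\<close> from \<open>o\<close>, then the part of
  \<open>D\<^sub>1(o)\<close> that neither of them covers consists of two caps at the rim, orthogonal to that
  direction, of length \<open>O(d)\<close> and thickness \<open>O(d\<^sup>2)\<close>. Their area is \<open>O(d\<^sup>3)\<close>, and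
  \<open>b (log b)\<^bsup>3/2\<^esup> d\<^sup>3 = (log b)\<^bsup>-3/2\<^esup>\<close>.

  Cut \<open>D\<^sub>d(o)\<close> into \<open>k \<approx> 1/d\<close> pairs of opposite sectors. The number of pairs for which the first
  half of the blue points hits one sector and the second half hits the other is a sum of
  pairwise negatively correlated indicators whose mean is at least of order
  \<open>b\<^bsup>1/3\<^esup> / (log b)\<^sup>5\<close>, so by Chebyshev's inequality some pair is hit, up to an admissible
  probability. Take the first such pair. A point in the cap belonging to
  that pair lies outside \<open>D\<^sub>d(o)\<close>, so moving it does not change which pairs are hit; hence each point
  lies in the cap of the first pair with probability \<open>O(d\<^sup>3)\<close>, and a union bound over the
  \<open>w + b\<close> points finishes the proof.\<close>

subsection \<open>Hitting disjoint sets with independent points\<close>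

lemma prob_PiM_avoid:
  assumes M: "prob_space M" and I: "finite I" "B \<subseteq> I" and S: "S \<in> sets M"
  shows "measure (PiM I (\<lambda>_. M)) {X \<in> space (PiM I (\<lambda>_. M)). \<forall>i\<in>B. X i \<notin> S}
    = (1 - measure M S) ^ card B"
proof -
  interpret M: prob_space M by fact
  interpret P: finite_product_prob_space "\<lambda>_. M" I
    by standard (use I in auto)
  have "{X \<in> space (PiM I (\<lambda>_. M)). \<forall>i\<in>B. X i \<notin> S}
      = PiE I (\<lambda>i. if i \<in> B then space M - S else space M)"
    using I(2) by (auto simp: space_PiM PiE_iff extensional_def split: if_splits)
  then have "measure (PiM I (\<lambda>_. M)) {X \<in> space (PiM I (\<lambda>_. M)). \<forall>i\<in>B. X i \<notin> S}
      = (\<Prod>i\<in>I. measure M (if i \<in> B then space M - S else space M))"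
    using S by (simp add: P.prob_times)
  also have "\<dots> = (\<Prod>i\<in>I. if i \<in> B then 1 - measure M S else 1)"
    using S by (intro prod.cong) (auto simp: M.prob_compl M.prob_space)
  also have "\<dots> = (1 - measure M S) ^ card B"
    using I by (simp add: prod.If_cases Int_absorb1)
  finally show ?thesis .
qed

lemma measurable_exists_component [measurable (raw)]:
  assumes "finite B" "B \<subseteq> I" "S \<in> sets M"
  shows "Measurable.pred (PiM I (\<lambda>_. M)) (\<lambda>X. \<exists>i\<in>B. X i \<in> S)"
proof -
  have "Measurable.pred (PiM I (\<lambda>_. M)) (\<lambda>X. X i \<in> S)" if "i \<in> B" for i
    by measurable (use assms that in auto)
  then show ?thesis using assms(1) by (intro pred_intros_finite(4)) auto
qed

text \<open>Hitting disjoint sets is negatively correlated. By inclusion-exclusion the joint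
  probability involves \<open>(1 - s - t) ^ card B\<close>, where \<open>s\<close> and
  \<open>t\<close> are the measures of the two sets, and
  \<open>1 - s - t \<le> (1 - s) * (1 - t)\<close>.\<close>

lemma prob_PiM_hit_disjoint:
  assumes M: "prob_space M" and I: "finite I" "B \<subseteq> I"
    and S: "S \<in> sets M" and T: "T \<in> sets M" and "S \<inter> T = {}"
  shows "measure (PiM I (\<lambda>_. M)) {X \<in> space (PiM I (\<lambda>_. M)). (\<exists>i\<in>B. X i \<in> S) \<and> (\<exists>i\<in>B. X i \<in> T)}
    \<le> (1 - (1 - measure M S) ^ card B) * (1 - (1 - measure M T) ^ card B)"
proof -
  interpret M: prob_space M by fact
  interpret P: finite_product_prob_space "\<lambda>_. M" I
    by standard (use I in auto)
  let ?P = "PiM I (\<lambda>_. M)"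
  let ?N = "\<lambda>S. {X \<in> space ?P. \<forall>i\<in>B. X i \<notin> S}"
  have fB: "finite B" using I by (auto intro: finite_subset)
  have N: "?N U \<in> sets ?P" if "U \<in> sets M" for U
  proof -
    have "{X \<in> space ?P. \<exists>i\<in>B. X i \<in> U} \<in> sets ?P"
      using measurable_exists_component[OF fB I(2) that] by measurable
    moreover have "?N U = space ?P - {X \<in> space ?P. \<exists>i\<in>B. X i \<in> U}" by auto
    ultimately show ?thesis by auto
  qed
  have eq: "?N S \<inter> ?N T = ?N (S \<union> T)" by auto
  have ST: "measure M (S \<union> T) = measure M S + measure M T"
    using assms by (simp add: M.finite_measure_Union)
  then have le1: "measure M S + measure M T \<le> 1"
    using M.prob_le_1[of "S \<union> T"] by simp
  have "measure ?P {X \<in> space ?P. (\<exists>i\<in>B. X i \<in> S) \<and> (\<exists>i\<in>B. X i \<in> T)}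
      = measure ?P (space ?P - (?N S \<union> ?N T))"
    by (rule arg_cong[where f="measure ?P"]) auto
  also have "\<dots> = 1 - measure ?P (?N S \<union> ?N T)"
    using N S T by (intro P.prob_compl) auto
  also have "measure ?P (?N S \<union> ?N T) = measure ?P (?N S) + measure ?P (?N T) - measure ?P (?N (S \<union> T))"
    using measure_Un3[of "?N S" ?P "?N T"] N[OF S] N[OF T] unfolding eq
    by (simp add: P.fmeasurable_eq_sets)
  also have "1 - \<dots> = 1 - (1 - measure M S) ^ card B - (1 - measure M T) ^ card B
      + (1 - (measure M S + measure M T)) ^ card B"
    using prob_PiM_avoid[OF M I S] prob_PiM_avoid[OF M I T] prob_PiM_avoid[OF M I, of "S \<union> T"] S T ST
    by (simp del: Un_iff)
  also have "(1 - (measure M S + measure M T)) ^ card B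
      \<le> (1 - measure M S) ^ card B * (1 - measure M T) ^ card B"
    unfolding power_mult_distrib[symmetric] using le1 by (intro power_mono) (auto simp: algebra_simps)
  finally show ?thesis by (simp add: algebra_simps)
qed

text \<open>The coordinates are independent under the product measure, hence so are their
  restrictions to disjoint index blocks. This separates the block aimed at the sets
  \<open>S j\<close> from the block aimed at the sets \<open>T j\<close>.\<close>

lemma prob_PiM_indep:
  assumes M: "prob_space M" and I: "finite I" "A \<subseteq> I" "B \<subseteq> I" "A \<inter> B = {}" and "I \<noteq> {}"
    and F: "F \<in> sets (PiM A (\<lambda>_. M))" and G: "G \<in> sets (PiM B (\<lambda>_. M))"
  shows "measure (PiM I (\<lambda>_. M)) {X \<in> space (PiM I (\<lambda>_. M)). restrict X A \<in> F \<and> restrict X B \<in> G}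
    = measure (PiM I (\<lambda>_. M)) {X \<in> space (PiM I (\<lambda>_. M)). restrict X A \<in> F} *
      measure (PiM I (\<lambda>_. M)) {X \<in> space (PiM I (\<lambda>_. M)). restrict X B \<in> G}"
proof -
  interpret M: prob_space M by fact
  interpret P: product_prob_space "\<lambda>_. M" I
    by standard 
  let ?P = "PiM I (\<lambda>_. M)"
    have "P.indep_vars (\<lambda>_. M) (\<lambda>i X. X i) I"
    \<comment> \<open>The joint law of the coordinates is the product measure itself, since
      restricting to \<open>I\<close> changes no point of the product space.\<close>
    proof (subst P.indep_vars_iff_distr_eq_PiM')
      have "distr ?P ?P (\<lambda>x. restrict x I) = distr ?P ?P (\<lambda>x. x)"
        by (rule distr_cong) (auto simp: space_PiM)
      also have "\<dots> = ?P" by (rule distr_id) 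
      also have "\<dots> = PiM I (\<lambda>i. distr ?P M (\<lambda>X. X i))"
        by (intro PiM_cong) (auto simp: P.PiM_component)
      finally show "distr ?P ?P (\<lambda>x. restrict x I) = PiM I (\<lambda>i. distr ?P M (\<lambda>X. X i))" .
    qed (use \<open>I \<noteq> {}\<close> in auto)
    from P.indep_var_restrict[OF this I(4,2,3)]
    have "P.indep_var (PiM A (\<lambda>_. M)) (\<lambda>X. restrict X A) (PiM B (\<lambda>_. M)) (\<lambda>X. restrict X B)" .
    from P.indep_varD[OF this F G] show ?thesis
      by (simp add: vimage_def Int_def conj_ac)
qed


text \<open>Second moment method. The number \<open>Z\<close> of indices \<open>j\<close> hit on
  both sides is a sum of pairwise non-positively correlated indicators, so its variance is at most
  its mean \<open>\<mu>\<close>. Chebyshev's inequality bounds the probability of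
  \<open>Z = 0\<close> by \<open>1 / \<mu>\<close>, and each index contributes at least
  \<open>(1 - (1 - q) ^ m)\<^sup>2\<close> to \<open>\<mu>\<close>.\<close>

lemma prob_PiM_no_double_hit:
  assumes M: "prob_space M" and I: "finite I" "A \<subseteq> I" "B \<subseteq> I" "A \<inter> B = {}"
    and card: "card A = m" "card B = m" "0 < m"
    and S: "\<And>j. j < k \<Longrightarrow> S j \<in> sets M" "\<And>j l. j < k \<Longrightarrow> l < k \<Longrightarrow> j \<noteq> l \<Longrightarrow> S j \<inter> S l = {}"
      "\<And>j. j < k \<Longrightarrow> q \<le> measure M (S j)"
    and T: "\<And>j. j < k \<Longrightarrow> T j \<in> sets M" "\<And>j l. j < k \<Longrightarrow> l < k \<Longrightarrow> j \<noteq> l \<Longrightarrow> T j \<inter> T l = {}"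
      "\<And>j. j < k \<Longrightarrow> q \<le> measure M (T j)"
    and "0 < q" "0 < k"
  shows "measure (PiM I (\<lambda>_. M))
      {X \<in> space (PiM I (\<lambda>_. M)). \<forall>j<k. \<not> ((\<exists>i\<in>A. X i \<in> S j) \<and> (\<exists>i\<in>B. X i \<in> T j))}
    \<le> 1 / (real k * (1 - (1 - q) ^ m)\<^sup>2)" (is ?bound)
    and "{X \<in> space (PiM I (\<lambda>_. M)). \<forall>j<k. \<not> ((\<exists>i\<in>A. X i \<in> S j) \<and> (\<exists>i\<in>B. X i \<in> T j))}
      \<in> sets (PiM I (\<lambda>_. M))" (is ?meas)
proof -
  interpret M: prob_space M by fact
  interpret P: finite_product_prob_space "\<lambda>_. M" I
    by standard (use I in auto)
  define P where "P = PiM I (\<lambda>_. M)"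
  interpret PP: prob_space P unfolding P_def by (rule P.prob_space_axioms)
  define E where "E j = {X \<in> space P. (\<exists>i\<in>A. X i \<in> S j) \<and> (\<exists>i\<in>B. X i \<in> T j)}" for j
  define s where "s j = 1 - (1 - measure M (S j)) ^ m" for j
  define t where "t j = 1 - (1 - measure M (T j)) ^ m" for j
  define r where "r = 1 - (1 - q) ^ m"
  have fin: "finite A" "finite B" using I by (auto intro: finite_subset)
  have "I \<noteq> {}" using I card by auto
  have q1: "q \<le> 1" using S(3)[OF \<open>0 < k\<close>] M.prob_le_1 order_trans by blast
  have "(1 - q) ^ m \<le> (1 - q) ^ 1"
    using q1 card \<open>0 < q\<close> by (intro power_decreasing) auto
  then have r: "0 < r" using \<open>0 < q\<close> by (simp add: r_def)
  have rs: "r \<le> s j" "r \<le> t j" if "j < k" for j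
    unfolding r_def s_def t_def using S(3)[OF that] T(3)[OF that]
    by (auto intro!: power_mono simp: M.prob_le_1)
  have pred: "Measurable.pred (PiM J (\<lambda>_. M)) (\<lambda>X. \<exists>i\<in>C. X i \<in> U)" 
    if "C \<subseteq> J" "finite C" "U \<in> sets M" for C J U
    using measurable_exists_component that by blast
  have hit: "measure P {X \<in> space P. \<exists>i\<in>C. X i \<in> U} = 1 - (1 - measure M U) ^ card C"
    if "C \<subseteq> I" "U \<in> sets M" for C U
  proof -
    have "{X \<in> space P. \<exists>i\<in>C. X i \<in> U} \<in> sets P"
      using pred[OF that(1) finite_subset[OF that(1) I(1)] that(2)] unfolding P_def by measurable
    moreover have "{X \<in> space P. \<forall>i\<in>C. X i \<notin> U} = space P - {X \<in> space P. \<exists>i\<in>C. X i \<in> U}" by auto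
    ultimately have "measure P {X \<in> space P. \<forall>i\<in>C. X i \<notin> U} = 1 - measure P {X \<in> space P. \<exists>i\<in>C. X i \<in> U}"
      using PP.prob_compl by simp
    then show ?thesis using prob_PiM_avoid[OF M I(1) that] unfolding P_def by simp
  qed
  \<comment> \<open>The indices \<open>j\<close> and \<open>l\<close> may coincide, so this
    factorization serves both for single events (\<open>PE\<close>) and for pairs
    (\<open>PEE\<close>).\<close>
  have split: "measure P {X \<in> space P. ((\<exists>i\<in>A. X i \<in> S j) \<and> (\<exists>i\<in>A. X i \<in> S l)) \<and> ((\<exists>i\<in>B. X i \<in> T j) \<and> (\<exists>i\<in>B. X i \<in> T l))}
     = measure P {X \<in> space P. (\<exists>i\<in>A. X i \<in> S j) \<and> (\<exists>i\<in>A. X i \<in> S l)} *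
       measure P {X \<in> space P. (\<exists>i\<in>B. X i \<in> T j) \<and> (\<exists>i\<in>B. X i \<in> T l)}"
    if "j < k" "l < k" for j l
  proof -
    define F where "F = {X \<in> space (PiM A (\<lambda>_. M)). (\<exists>i\<in>A. X i \<in> S j) \<and> (\<exists>i\<in>A. X i \<in> S l)}"
    define G where "G = {X \<in> space (PiM B (\<lambda>_. M)). (\<exists>i\<in>B. X i \<in> T j) \<and> (\<exists>i\<in>B. X i \<in> T l)}"
    note [measurable] = pred[OF order_refl fin(1) S(1)[OF that(1)]] pred[OF order_refl fin(1) S(1)[OF that(2)]]
      pred[OF order_refl fin(2) T(1)[OF that(1)]] pred[OF order_refl fin(2) T(1)[OF that(2)]]
    have "F \<in> sets (PiM A (\<lambda>_. M))" "G \<in> sets (PiM B (\<lambda>_. M))" unfolding F_def G_def by measurable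
    note * = prob_PiM_indep[OF M I \<open>I \<noteq> {}\<close> this]
    have F': "restrict X A \<in> F \<longleftrightarrow> (\<exists>i\<in>A. X i \<in> S j) \<and> (\<exists>i\<in>A. X i \<in> S l)" if "X \<in> space P" for X
      using that I unfolding P_def F_def by (auto simp: space_PiM PiE_iff)
    have G': "restrict X B \<in> G \<longleftrightarrow> (\<exists>i\<in>B. X i \<in> T j) \<and> (\<exists>i\<in>B. X i \<in> T l)" if "X \<in> space P" for X
      using that I unfolding P_def G_def by (auto simp: space_PiM PiE_iff)
    show ?thesis
      using *[folded P_def] by (simp only: F' G' cong: conj_cong)
  qed
  have E[measurable]: "E j \<in> sets P" if "j < k" for j
  proof -
    note [measurable] = pred[OF I(2) fin(1) S(1)[OF that]] pred[OF I(3) fin(2) T(1)[OF that]]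
    show ?thesis unfolding E_def P_def by measurable
  qed
  have PE: "measure P (E j) = s j * t j" if "j < k" for j
    using split[OF that that] hit[OF I(2) S(1)[OF that]] hit[OF I(3) T(1)[OF that]] card
    by (simp add: E_def s_def t_def)
  have PEE: "measure P (E j \<inter> E l) \<le> (s j * t j) * (s l * t l)" if "j < k" "l < k" "j \<noteq> l" for j l
  proof -
    have "E j \<inter> E l = {X \<in> space P. ((\<exists>i\<in>A. X i \<in> S j) \<and> (\<exists>i\<in>A. X i \<in> S l)) \<and> ((\<exists>i\<in>B. X i \<in> T j) \<and> (\<exists>i\<in>B. X i \<in> T l))}"
      by (auto simp: E_def)
    then have "measure P (E j \<inter> E l) = measure P {X \<in> space P. (\<exists>i\<in>A. X i \<in> S j) \<and> (\<exists>i\<in>A. X i \<in> S l)} *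
       measure P {X \<in> space P. (\<exists>i\<in>B. X i \<in> T j) \<and> (\<exists>i\<in>B. X i \<in> T l)}"
      using split[OF that(1,2)] by simp
    also have "\<dots> \<le> (s j * s l) * (t j * t l)"
    proof (intro mult_mono)
      show "measure P {X \<in> space P. (\<exists>i\<in>A. X i \<in> S j) \<and> (\<exists>i\<in>A. X i \<in> S l)} \<le> s j * s l"
        using prob_PiM_hit_disjoint[OF M I(1,2) S(1)[OF that(1)] S(1)[OF that(2)] S(2)[OF that]] card
        by (simp add: P_def s_def)
      show "measure P {X \<in> space P. (\<exists>i\<in>B. X i \<in> T j) \<and> (\<exists>i\<in>B. X i \<in> T l)} \<le> t j * t l"
        using prob_PiM_hit_disjoint[OF M I(1,3) T(1)[OF that(1)] T(1)[OF that(2)] T(2)[OF that]] card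
        by (simp add: P_def t_def)
      show "0 \<le> s j * s l" using rs that r by (meson less_imp_le mult_nonneg_nonneg order_trans)
    qed simp
    finally show ?thesis by (simp add: mult_ac)
  qed
  define \<mu> where "\<mu> = (\<Sum>j<k. s j * t j)"
  have "(\<Sum>j<k. r * r) \<le> \<mu>"
    unfolding \<mu>_def using rs r by (intro sum_mono mult_mono) (auto intro: order_trans[OF less_imp_le])
  then have mu: "real k * r\<^sup>2 \<le> \<mu>" by (simp add: power2_eq_square)
  have mu0: "0 < \<mu>" using mu r \<open>0 < k\<close> by (smt (verit) of_nat_0_less_iff zero_less_mult_iff zero_less_power)
  define Z where "Z X = (\<Sum>j<k. indicator (E j) X :: real)" for X
  have Zm[measurable]: "Z \<in> borel_measurable P" unfolding Z_def by measurable
  have Z2: "(Z X)\<^sup>2 = (\<Sum>j<k. \<Sum>l<k. indicator (E j \<inter> E l) X)" for X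
    by (simp add: Z_def power2_eq_square sum_product indicator_inter_arith)
  have int: "integrable P (indicator F :: _ \<Rightarrow> real)" if "F \<in> sets P" for F
    using that by (simp add: PP.emeasure_finite less_top[symmetric])
  have iZ: "integrable P Z" unfolding Z_def using int E by auto
  have iZ2: "integrable P (\<lambda>X. (Z X)\<^sup>2)"
    unfolding Z2 using E by (intro Bochner_Integration.integrable_sum int) auto
  have EZ: "PP.expectation Z = \<mu>"
    unfolding Z_def \<mu>_def using int E PE by (simp add: Bochner_Integration.integral_sum)
  have "PP.expectation (\<lambda>X. (Z X)\<^sup>2) = (\<Sum>j<k. \<Sum>l<k. measure P (E j \<inter> E l))"
    unfolding Z2 using E
    by (subst Bochner_Integration.integral_sum, auto intro!: Bochner_Integration.integrable_sum int sum.cong)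
      (subst Bochner_Integration.integral_sum, auto intro!: int sum.cong)
  \<comment> \<open>On the diagonal the added term alone equals \<open>measure P (E j)\<close>.
    Keeping the product there too completes the double sum to \<open>\<mu>\<^sup>2\<close>, so that
    only \<open>\<mu>\<close> remains for the variance.\<close>
  also have "\<dots> \<le> (\<Sum>j<k. \<Sum>l<k. (s j * t j) * (s l * t l) + (if l = j then s j * t j else 0))"
  proof (intro sum_mono)
    fix j l assume "j \<in> {..<k}" "l \<in> {..<k}"
    then show "measure P (E j \<inter> E l) \<le> (s j * t j) * (s l * t l) + (if l = j then s j * t j else 0)"
      using PEE[of j l] PE[of j] by auto
  qed
  also have "\<dots> = \<mu>\<^sup>2 + \<mu>"
    by (simp add: sum.distrib \<mu>_def power2_eq_square sum_product)
  finally have "PP.variance Z \<le> \<mu>" using PP.variance_eq[OF iZ iZ2] EZ by simp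
  then have var: "PP.variance Z / \<mu>\<^sup>2 \<le> \<mu> / \<mu>\<^sup>2" by (intro divide_right_mono) auto
  have "measure P {X \<in> space P. \<forall>j<k. \<not> ((\<exists>i\<in>A. X i \<in> S j) \<and> (\<exists>i\<in>B. X i \<in> T j))}
      \<le> measure P {X \<in> space P. \<mu> \<le> \<bar>Z X - PP.expectation Z\<bar>}"
  proof (intro PP.finite_measure_mono subsetI)
    fix X assume X: "X \<in> {X \<in> space P. \<forall>j<k. \<not> ((\<exists>i\<in>A. X i \<in> S j) \<and> (\<exists>i\<in>B. X i \<in> T j))}"
    then have "Z X = 0" by (auto simp: Z_def E_def intro!: sum.neutral)
    then show "X \<in> {X \<in> space P. \<mu> \<le> \<bar>Z X - PP.expectation Z\<bar>}" using X EZ mu0 by simp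
  qed measurable
  also have "\<dots> \<le> PP.variance Z / \<mu>\<^sup>2"
    by (rule PP.Chebyshev_inequality[OF Zm iZ2 mu0])
  also have "\<dots> \<le> \<mu> / \<mu>\<^sup>2" by (rule var)
  also have "\<dots> = 1 / \<mu>" by (simp add: power2_eq_square)
  also have "\<dots> \<le> 1 / (real k * r\<^sup>2)"
    using mu mu0 r \<open>0 < k\<close> by (intro divide_left_mono) auto
  finally show ?bound unfolding P_def r_def .
  have "space P - (\<Union>j<k. E j) \<in> sets P" using E by auto
  also have "space P - (\<Union>j<k. E j)
      = {X \<in> space P. \<forall>j<k. \<not> ((\<exists>i\<in>A. X i \<in> S j) \<and> (\<exists>i\<in>B. X i \<in> T j))}"
    by (auto simp: E_def)
  finally show ?meas unfolding P_def .
qed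

section \<open>Moving one point while the others stay fixed\<close>

text \<open>Tonelli with the \<open>i\<close>-th coordinate integrated innermost: a bound on all
  one-point sections survives averaging over the other points.\<close>

lemma emeasure_PiM_le_sections:
  assumes M: "prob_space M" and I: "finite I" "i \<in> I"
    and F: "F \<in> sets (PiM I (\<lambda>_. M))"
    and sec: "\<And>X. X \<in> space (PiM (I - {i}) (\<lambda>_. M)) \<Longrightarrow> emeasure M {x \<in> space M. X(i := x) \<in> F} \<le> K"
  shows "emeasure (PiM I (\<lambda>_. M)) F \<le> K"
proof -
  interpret M: prob_space M by fact
  interpret P: product_prob_space "\<lambda>_. M" I by standard
  interpret Q: product_prob_space "\<lambda>_. M" "I - {i}" by standard
  have I': "insert i (I - {i}) = I" using I by auto
  have "emeasure (PiM I (\<lambda>_. M)) F = (\<integral>\<^sup>+X. indicator F X \<partial>PiM I (\<lambda>_. M))"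
    using F by simp
  also have "\<dots> = (\<integral>\<^sup>+X. (\<integral>\<^sup>+x. indicator F (X(i := x)) \<partial>M) \<partial>PiM (I - {i}) (\<lambda>_. M))"
    using P.product_nn_integral_insert[of "I - {i}" i "indicator F"] I F unfolding I' by simp
  also have "\<dots> \<le> (\<integral>\<^sup>+X. K \<partial>PiM (I - {i}) (\<lambda>_. M))"
  proof (rule nn_integral_mono)
    fix X assume X: "X \<in> space (PiM (I - {i}) (\<lambda>_. M))"
    have "(\<lambda>x. X(i := x)) \<in> measurable M (PiM (insert i (I - {i})) (\<lambda>_. M))"
      using X by measurable
    then have "(\<lambda>x. X(i := x)) -` F \<inter> space M \<in> sets M"
      unfolding I' using F by (rule measurable_sets)
    then have "{x \<in> space M. X(i := x) \<in> F} \<in> sets M"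
      by (simp add: vimage_def Int_def conj_commute)
    then have "emeasure M {x \<in> space M. X(i := x) \<in> F} = (\<integral>\<^sup>+x. indicator {x \<in> space M. X(i := x) \<in> F} x \<partial>M)"
      by simp
    also have "\<dots> = (\<integral>\<^sup>+x. indicator F (X(i := x)) \<partial>M)"
      by (intro nn_integral_cong) (auto simp: indicator_def)
    finally show "(\<integral>\<^sup>+x. indicator F (X(i := x)) \<partial>M) \<le> K" using sec[OF X] by simp
  qed
  also have "\<dots> = K" by (simp add: Q.P.emeasure_space_1)
  finally show ?thesis .
qed

text \<open>The gain is that no factor \<open>k\<close> appears. The union bound runs over the
  points only; for each point, with the others fixed, the section of the bad event lies in a single
  \<open>U j\<close>, because \<open>disj\<close> prevents a point of any \<open>U j\<close> from
  deciding which index is hit first.\<close>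

lemma prob_PiM_first_double_hit:
  fixes k :: nat
  assumes M: "prob_space M" and I: "finite I" "A \<subseteq> I" "B \<subseteq> I"
    and S: "\<And>j. j < k \<Longrightarrow> S j \<in> sets M" and T: "\<And>j. j < k \<Longrightarrow> T j \<in> sets M"
    and U: "\<And>j. j < k \<Longrightarrow> U j \<in> sets M" "\<And>j. j < k \<Longrightarrow> measure M (U j) \<le> K" "0 \<le> K"
    and disj: "\<And>j l. j < k \<Longrightarrow> l < k \<Longrightarrow> U j \<inter> (S l \<union> T l) = {}"
  defines "E \<equiv> \<lambda>X j. (\<exists>i\<in>A. X i \<in> S j) \<and> (\<exists>i\<in>B. X i \<in> T j)"
  shows "measure (PiM I (\<lambda>_. M)) {X \<in> space (PiM I (\<lambda>_. M)).
      \<exists>i\<in>I. \<exists>j<k. E X j \<and> (\<forall>l<j. \<not> E X l) \<and> X i \<in> U j} \<le> real (card I) * K"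
    and "{X \<in> space (PiM I (\<lambda>_. M)).
      \<exists>i\<in>I. \<exists>j<k. E X j \<and> (\<forall>l<j. \<not> E X l) \<and> X i \<in> U j} \<in> sets (PiM I (\<lambda>_. M))"
proof -
  interpret M: prob_space M by fact
  interpret P: product_prob_space "\<lambda>_. M" I by standard
  let ?P = "PiM I (\<lambda>_. M)"
  have fin: "finite A" "finite B" using I by (auto intro: finite_subset)
  define F where "F i = {X \<in> space ?P. \<exists>j<k. E X j \<and> (\<forall>l<j. \<not> E X l) \<and> X i \<in> U j}" for i
  have F: "F i \<in> sets ?P" if "i \<in> I" for i
  proof -
    have E: "Measurable.pred ?P (\<lambda>X. E X j)" if "j < k" for j
    proof -
      note [measurable] = measurable_exists_component[OF fin(1) I(2) S[OF that]]
        measurable_exists_component[OF fin(2) I(3) T[OF that]]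
      show ?thesis unfolding E_def by measurable
    qed
    have G: "{X \<in> space ?P. E X j \<and> (\<forall>l<j. \<not> E X l) \<and> X i \<in> U j} \<in> sets ?P" if "j < k" for j
    proof -
      have [measurable]: "Measurable.pred ?P (\<lambda>X. E X l)" if "l \<in> {..<j}" for l
        using E[of l] that \<open>j < k\<close> by simp
      have "Measurable.pred ?P (\<lambda>X. \<forall>l\<in>{..<j}. \<not> E X l)"
        by (intro pred_intros_finite) auto
      then have [measurable]: "Measurable.pred ?P (\<lambda>X. \<forall>l<j. \<not> E X l)" by simp
      note [measurable] = E[OF \<open>j < k\<close>] U(1)[OF \<open>j < k\<close>]
      show ?thesis using \<open>i \<in> I\<close> by measurable
    qed
    have "F i = (\<Union>j<k. {X \<in> space ?P. E X j \<and> (\<forall>l<j. \<not> E X l) \<and> X i \<in> U j})"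
      unfolding F_def by auto
    then show ?thesis using G by auto
  qed
  have eq: "{X \<in> space ?P. \<exists>i\<in>I. \<exists>j<k. E X j \<and> (\<forall>l<j. \<not> E X l) \<and> X i \<in> U j} = (\<Union>i\<in>I. F i)"
    unfolding F_def by auto
  show "{X \<in> space ?P. \<exists>i\<in>I. \<exists>j<k. E X j \<and> (\<forall>l<j. \<not> E X l) \<and> X i \<in> U j} \<in> sets ?P"
    unfolding eq using F I by auto
  have bound: "measure ?P (F i) \<le> K" if "i \<in> I" for i
  proof -
    have "emeasure ?P (F i) \<le> ennreal K"
    proof (rule emeasure_PiM_le_sections[OF M I(1) that F[OF that]])
      fix X assume X: "X \<in> space (PiM (I - {i}) (\<lambda>_. M))"
      let ?L = "{x \<in> space M. X(i := x) \<in> F i}"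
      \<comment> \<open>A point of \<open>U j\<close> does not influence which sets are hit, so the first index hit
        is the same on the whole section.\<close>
      have same: "E (X(i := x)) l \<longleftrightarrow> E (X(i := y)) l"
        if "x \<in> U j" "y \<in> U j'" "j < k" "j' < k" "l < k" for x y j j' l
        using disj[OF that(3,5)] disj[OF that(4,5)] that(1,2) unfolding E_def by auto
      show "emeasure M ?L \<le> ennreal K"
      proof (cases "?L = {}")
        case False
        then obtain x j where xj: "j < k" "E (X(i := x)) j" "\<And>l. l < j \<Longrightarrow> \<not> E (X(i := x)) l" "x \<in> U j"
          by (auto simp: F_def)
        have "?L \<subseteq> U j"
        proof
          fix y assume "y \<in> ?L"
          then obtain j' where j': "j' < k" "E (X(i := y)) j'" "\<And>l. l < j' \<Longrightarrow> \<not> E (X(i := y)) l" "y \<in> U j'"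
            by (auto simp: F_def)
          have "\<not> j < j'" using j'(3)[of j] same[OF xj(4) j'(4) xj(1) j'(1) xj(1)] xj(2) by auto
          moreover have "\<not> j' < j" using xj(3)[of j'] same[OF xj(4) j'(4) xj(1) j'(1) j'(1)] j'(2) by auto
          ultimately show "y \<in> U j" using j'(4) by (metis linorder_neqE_nat)
        qed
        then have "emeasure M ?L \<le> emeasure M (U j)" using U(1)[OF xj(1)] by (rule emeasure_mono)
        also have "\<dots> \<le> ennreal K" using U(2)[OF xj(1)] by (simp add: M.emeasure_eq_measure ennreal_leI)
        finally show ?thesis .
      qed (metis emeasure_empty zero_le)
    qed
    then show ?thesis using U(3) by (simp add: P.P.emeasure_eq_measure)
  qed
  have "measure ?P (\<Union>i\<in>I. F i) \<le> (\<Sum>i\<in>I. measure ?P (F i))"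
    using F I by (intro P.P.finite_measure_subadditive_finite) auto
  also have "\<dots> \<le> (\<Sum>i\<in>I. K)" by (intro sum_mono bound)
  finally show "measure ?P {X \<in> space ?P. \<exists>i\<in>I. \<exists>j<k. E X j \<and> (\<forall>l<j. \<not> E X l) \<and> X i \<in> U j} \<le> real (card I) * K"
    unfolding eq by simp
qed

subsection \<open>Opposite sectors and uncovered caps\<close>

lemma emeasure_lborel_ge_sections:
  fixes A :: "(real \<times> real) set"
  assumes A: "A \<in> sets borel" and "a \<le> b" "0 \<le> l"
    and sec: "\<And>x. x \<in> {a..b} \<Longrightarrow> ennreal l \<le> emeasure lborel (Pair x -` A)"
  shows "ennreal ((b - a) * l) \<le> emeasure lborel A"
proof -
  have "ennreal ((b - a) * l) = (\<integral>\<^sup>+x. ennreal l * indicator {a..b} x \<partial>lborel)"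
    using assms by (subst nn_integral_cmult_indicator) (auto simp: ennreal_mult' mult.commute)
  also have "\<dots> \<le> (\<integral>\<^sup>+x. emeasure lborel (Pair x -` A) \<partial>lborel)"
    using sec by (intro nn_integral_mono) (auto simp: indicator_def)
  also have "\<dots> = emeasure (lborel \<Otimes>\<^sub>M lborel) A"
    using A by (intro lborel.emeasure_pair_measure_alt[symmetric]) (simp only: lborel_prod sets_lborel)
  finally show ?thesis by (simp add: lborel_prod)
qed

lemma emeasure_lborel_le_sections:
  fixes A :: "(real \<times> real) set"
  assumes A: "A \<in> sets borel" and R: "R \<in> sets borel"
    and out: "\<And>x. x \<notin> R \<Longrightarrow> Pair x -` A = {}"
    and sec: "\<And>x. x \<in> R \<Longrightarrow> emeasure lborel (Pair x -` A) \<le> l"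
  shows "emeasure lborel A \<le> l * emeasure lborel R"
proof -
  have "emeasure lborel A = emeasure (lborel \<Otimes>\<^sub>M lborel) A"
    by (simp add: lborel_prod)
  also have "\<dots> = (\<integral>\<^sup>+x. emeasure lborel (Pair x -` A) \<partial>lborel)"
    using A by (intro lborel.emeasure_pair_measure_alt) (simp only: lborel_prod sets_lborel)
  also have "\<dots> \<le> (\<integral>\<^sup>+x. l * indicator R x \<partial>lborel)"
    using sec out by (intro nn_integral_mono) (auto simp: indicator_def)
  also have "\<dots> = l * emeasure lborel R"
    using R by (subst nn_integral_cmult_indicator) auto
  finally show ?thesis .
qed

text \<open>A trapezoid replaces a circular sector: slopes from \<open>p\<close> in
  \<open>[t, t + h)\<close>, abscissa offset in \<open>[a, 2 * a]\<close>. With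
  \<open>\<sigma> = -1\<close> it is reflected through \<open>p\<close>, which gives the opposite
  sector. The slope range is half-open so that sectors with consecutive slopes are disjoint.\<close>

definition sector :: "real \<times> real \<Rightarrow> real \<Rightarrow> real \<Rightarrow> real \<Rightarrow> real \<Rightarrow> (real \<times> real) set" where
  "sector p \<sigma> a h t = {z. a \<le> \<sigma> * (fst z - fst p) \<and> \<sigma> * (fst z - fst p) \<le> 2 * a \<and>
     t * (\<sigma> * (fst z - fst p)) \<le> \<sigma> * (snd z - snd p) \<and>
     \<sigma> * (snd z - snd p) < (t + h) * (\<sigma> * (fst z - fst p))}"

text \<open>A thin annulus at the unit circle around \<open>p\<close>, cut by a strip along the line
  through \<open>p\<close> orthogonal to the direction \<open>(1, t)\<close>. For small
  \<open>d\<close> this consists of two opposite pieces.\<close>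

definition cap :: "real \<times> real \<Rightarrow> real \<Rightarrow> real \<Rightarrow> (real \<times> real) set" where
  "cap p d t = {z. (fst z - fst p)\<^sup>2 + (snd z - snd p)\<^sup>2 \<le> 1 \<and>
     1 - 2 * d\<^sup>2 \<le> (fst z - fst p)\<^sup>2 + (snd z - snd p)\<^sup>2 \<and>
     \<bar>(fst z - fst p) + t * (snd z - snd p)\<bar> \<le> 2 * d}"

lemma sector_borel [measurable]: "sector p \<sigma> a h t \<in> sets borel"
proof -
  have "{z \<in> space (borel \<Otimes>\<^sub>M borel). a \<le> \<sigma> * (fst z - fst p) \<and> \<sigma> * (fst z - fst p) \<le> 2 * a \<and>
     t * (\<sigma> * (fst z - fst p)) \<le> \<sigma> * (snd z - snd p) \<and>
     \<sigma> * (snd z - snd p) < (t + h) * (\<sigma> * (fst z - fst p))} \<in> sets (borel \<Otimes>\<^sub>M borel)"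
    by measurable
  then show ?thesis unfolding borel_prod sector_def by simp
qed

lemma cap_borel [measurable]: "cap p d t \<in> sets borel"
proof -
  have "{z \<in> space (borel \<Otimes>\<^sub>M borel). (fst z - fst p)\<^sup>2 + (snd z - snd p)\<^sup>2 \<le> 1 \<and>
     1 - 2 * d\<^sup>2 \<le> (fst z - fst p)\<^sup>2 + (snd z - snd p)\<^sup>2 \<and>
     \<bar>(fst z - fst p) + t * (snd z - snd p)\<bar> \<le> 2 * d} \<in> sets (borel \<Otimes>\<^sub>M borel)"
    by measurable
  then show ?thesis unfolding borel_prod cap_def by simp
qed

text \<open>The slope of a point as seen from \<open>p\<close> determines the index, since the
  half-open slope intervals are disjoint; the abscissa offset is positive, so one may divide by
  it.\<close>

lemma sector_disjoint:
  fixes j l :: nat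
  assumes "0 < a" "0 < h" "j \<noteq> l"
  shows "sector p \<sigma> a h (real j * h) \<inter> sector p \<sigma> a h (real l * h) = {}"
proof -
  have False if "i < k" "z \<in> sector p \<sigma> a h (real i * h)" "z \<in> sector p \<sigma> a h (real k * h)" for i k :: nat and z
  proof -
    define x where "x = \<sigma> * (fst z - fst p)"
    have "0 < x" using that(2) assms unfolding sector_def x_def by auto
    have "real k * h * x < (real i * h + h) * x"
      using that(2,3) unfolding sector_def x_def by auto
    then have "real k * h < (real i + 1) * h" using \<open>0 < x\<close> mult_less_cancel_right_pos[of x "real k * h" "real i * h + h"]
      by (simp add: distrib_right)
    then have "real k < real i + 1" using assms by simp
    then show False using that(1) by linarith
  qed
  then show ?thesis using assms(3) by (metis disjoint_iff linorder_neqE_nat)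
qed

text \<open>Slopes are at most 1, so both offsets are at most \<open>2 * a\<close> in absolute
  value. The case \<open>a = d / 4\<close> places the sectors inside the disk of radius
  \<open>d\<close>.\<close>

lemma sector_subset_cball:
  assumes "0 \<le> t" "t + h \<le> 1" "0 < a" "\<sigma>\<^sup>2 = 1"
  shows "sector p \<sigma> a h t \<subseteq> cball p (4 * a)"
proof
  fix z assume z: "z \<in> sector p \<sigma> a h t"
  define x where "x = \<sigma> * (fst z - fst p)"
  define y where "y = \<sigma> * (snd z - snd p)"
  have x: "a \<le> x" "x \<le> 2 * a" "t * x \<le> y" "y < (t + h) * x"
    using z unfolding sector_def x_def y_def by auto
  have "0 \<le> t * x" using assms x by auto
  moreover have "(t + h) * x \<le> 1 * x" using assms x by (intro mult_right_mono) auto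
  ultimately have "0 \<le> y" "y \<le> 2 * a" using x by auto
  then have "x\<^sup>2 + y\<^sup>2 \<le> (2 * a)\<^sup>2 + (2 * a)\<^sup>2"
    using x assms by (intro add_mono power_mono) auto
  also have "\<dots> \<le> (4 * a)\<^sup>2" by (simp add: power2_eq_square)
  finally have "x\<^sup>2 + y\<^sup>2 \<le> (4 * a)\<^sup>2" .
  moreover have "x\<^sup>2 + y\<^sup>2 = (fst z - fst p)\<^sup>2 + (snd z - snd p)\<^sup>2"
    unfolding x_def y_def using assms by (simp add: power_mult_distrib)
  ultimately have "sqrt ((fst z - fst p)\<^sup>2 + (snd z - snd p)\<^sup>2) \<le> 4 * a"
    using assms by (intro real_le_lsqrt) auto
  then show "z \<in> cball p (4 * a)"
    by (simp add: dist_prod_def dist_real_def power2_commute[of "fst p"] power2_commute[of "snd p"])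
qed

lemma emeasure_sector_ge:
  assumes "0 < a" "0 < h" "\<sigma> = 1 \<or> \<sigma> = -1"
  shows "ennreal (h * a\<^sup>2) \<le> emeasure lborel (sector p \<sigma> a h t)"
proof -
  define b where "b = (if \<sigma> = 1 then fst p + a else fst p - 2 * a)"
  have "ennreal ((b + a - b) * (h * a)) \<le> emeasure lborel (sector p \<sigma> a h t)"
  proof (rule emeasure_lborel_ge_sections)
    fix X assume X: "X \<in> {b..b + a}"
    define x where "x = \<sigma> * (X - fst p)"
    have x: "a \<le> x" "x \<le> 2 * a" using X assms(3) by (auto simp: x_def b_def split: if_splits)
    \<comment> \<open>Lower end of the vertical section. Reflection swaps its closed and open ends,
      so the open interval is used for both signs.\<close>
    define c where "c = (if \<sigma> = 1 then snd p + t * x else snd p - (t + h) * x)"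
    have "ennreal (h * a) \<le> ennreal (h * x)"
      using x assms by (intro ennreal_leI mult_left_mono) auto
    also have "\<dots> = emeasure lborel {c<..<c + h * x}" using x assms by simp
    also have "\<dots> \<le> emeasure lborel (Pair X -` sector p \<sigma> a h t)"
    proof (rule emeasure_mono)
      show "{c<..<c + h * x} \<subseteq> Pair X -` sector p \<sigma> a h t"
        using x assms(3) unfolding sector_def c_def x_def by (auto simp: algebra_simps)
      have "sector p \<sigma> a h t \<in> sets (lborel \<Otimes>\<^sub>M lborel)" by (simp only: lborel_prod sets_lborel sector_borel)
      then show "Pair X -` sector p \<sigma> a h t \<in> sets lborel" by (rule sets_Pair1)
    qed
    finally show "ennreal (h * a) \<le> emeasure lborel (Pair X -` sector p \<sigma> a h t)" .
  qed (use assms in auto)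
  then show ?thesis by (simp add: power2_eq_square mult_ac)
qed

text \<open>Take \<open>p\<close> as origin and write \<open>u = a (1, s)\<close>,
  \<open>v = - a' (1, s')\<close>, with slopes within \<open>d\<close> of \<open>t\<close> and
  \<open>a, a' \<le> d / 2\<close>. Being uncovered by \<open>u\<close> inside the unit disk forces
  \<open>x + s y < d / 2\<close>, and by \<open>v\<close> it forces
  \<open>- (x + s' y) < d / 2\<close>; together they give the strip. The thickness follows because
  \<open>v\<close> also bounds the inner product of \<open>z\<close> and \<open>u\<close> from
  below.\<close>

lemma uncovered_subset_cap:
  assumes u: "u \<in> sector p 1 (d / 4) h t" and v: "v \<in> sector p (-1) (d / 4) h t"
    and t: "0 \<le> t" "t + h \<le> 1" "h \<le> d" "0 < d"
    and z: "dist z p \<le> 1" "1 < dist z u" "1 < dist z v"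
  shows "z \<in> cap p d t"
proof -
  define x y where "x = fst z - fst p" and "y = snd z - snd p"
  \<comment> \<open>Expand the squared distance to \<open>w\<close>. Slope at most 1 in absolute
    value lets \<open>a\<^sup>2\<close> replace \<open>e\<^sup>2\<close>, and the first conclusion
    also uses that \<open>z\<close> lies in the unit disk.\<close>
  have one: "x * a + y * e < a\<^sup>2 \<and> 1 + 2 * (x * a + y * e) - 2 * a\<^sup>2 < x\<^sup>2 + y\<^sup>2"
    if "1 < dist z w" "fst w - fst p = a" "snd w - snd p = e" "e\<^sup>2 \<le> a\<^sup>2" for w a e
  proof -
    have "1 < (dist z w)\<^sup>2" using that(1) by simp
    also have "(dist z w)\<^sup>2 = (fst z - fst w)\<^sup>2 + (snd z - snd w)\<^sup>2"
      by (simp add: dist_prod_def dist_real_def)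
    also have "fst z - fst w = x - a" using that(2) x_def by simp
    also have "snd z - snd w = y - e" using that(3) y_def by simp
    finally have "1 < x\<^sup>2 + y\<^sup>2 - 2 * (x * a + y * e) + a\<^sup>2 + e\<^sup>2"
      by (simp add: power2_diff algebra_simps)
    moreover have "x\<^sup>2 + y\<^sup>2 \<le> 1"
      using z(1) unfolding x_def y_def by (auto simp: dist_prod_def dist_real_def)
    ultimately show ?thesis using that(4) by auto
  qed
  have le1: "x\<^sup>2 + y\<^sup>2 \<le> 1"
    using z(1) unfolding x_def y_def by (auto simp: dist_prod_def dist_real_def)
  then have "y\<^sup>2 \<le> 1" using zero_le_power2[of x] by linarith
  then have y1: "\<bar>y\<bar> \<le> 1" by (simp add: abs_square_le_1)
  have slope: "\<exists>s. e = s * a \<and> t \<le> s \<and> s < t + h \<and> s\<^sup>2 \<le> 1"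
    if "0 < a" "t * a \<le> e" "e < (t + h) * a" for a e
  proof (intro exI conjI)
    show "e = e / a * a" using that by simp
    show "t \<le> e / a" "e / a < t + h" using that by (auto simp: field_simps)
    then show "(e / a)\<^sup>2 \<le> 1" using t by (intro power_le_one) auto
  qed
  define a where "a = fst u - fst p"
  define a' where "a' = - (fst v - fst p)"
  have a: "0 < a" "a \<le> d / 2" and a': "0 < a'" "a' \<le> d / 2"
    using u v t unfolding sector_def a_def a'_def by auto
  obtain s where s: "snd u - snd p = s * a" "t \<le> s" "s < t + h" "s\<^sup>2 \<le> 1"
    using slope[of a "snd u - snd p"] u a unfolding sector_def a_def by auto
  obtain s' where s': "- (snd v - snd p) = s' * a'" "t \<le> s'" "s' < t + h" "s'\<^sup>2 \<le> 1"
    using slope[of a' "- (snd v - snd p)"] v a' unfolding sector_def a'_def by auto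
  have U: "x * a + y * (s * a) < a\<^sup>2" "1 + 2 * (x * a + y * (s * a)) - 2 * a\<^sup>2 < x\<^sup>2 + y\<^sup>2"
    using one[OF z(2) a_def[symmetric] s(1)] s(4) by (auto simp: power_mult_distrib mult_left_le_one_le)
  have V: "x * (- a') + y * (- (s' * a')) < (- a')\<^sup>2"
  proof (rule one[OF z(3), THEN conjunct1])
    show "fst v - fst p = - a'" by (simp add: a'_def)
    show "snd v - snd p = - (s' * a')" using s'(1) by simp
    show "(- (s' * a'))\<^sup>2 \<le> (- a')\<^sup>2" using s'(4) by (simp add: power_mult_distrib mult_left_le_one_le)
  qed
  have "(x + s * y) * a < a * a" using U(1) by (simp add: algebra_simps power2_eq_square)
  then have xs: "x + s * y < d / 2" using a by (simp add: mult_less_cancel_right)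
  have "(- (x + s' * y)) * a' < a' * a'" using V by (simp add: algebra_simps power2_eq_square)
  then have xs': "- (x + s' * y) < d / 2" using a' by (simp add: mult_less_cancel_right)
  have ch: "\<bar>(r - r') * y\<bar> \<le> d" if "\<bar>r - r'\<bar> \<le> d" for r r'
    using that y1 t mult_mono[of "\<bar>r - r'\<bar>" d "\<bar>y\<bar>" 1] by (simp add: abs_mult)
  have c1: "\<bar>(s - t) * y\<bar> \<le> d" "\<bar>(s' - t) * y\<bar> \<le> d" "\<bar>(s - s') * y\<bar> \<le> d"
    using s s' t by (auto intro!: ch)
  have strip: "\<bar>x + t * y\<bar> \<le> 2 * d"
    using xs xs' c1 t by (simp add: algebra_simps abs_le_iff)
  \<comment> \<open>The \<open>d / 2\<close> comes from \<open>v\<close>, the remaining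
    \<open>d\<close> from exchanging slope \<open>s'\<close> for \<open>s\<close>. After doubling,
    this costs \<open>3 / 2 * d\<^sup>2\<close> at the rim, and the term
    \<open>2 * a\<^sup>2 \<le> d\<^sup>2 / 2\<close> brings the loss to exactly
    \<open>2 * d\<^sup>2\<close>.\<close>
  have "- (3 / 2 * d) \<le> x + s * y"
    using xs' c1 by (simp add: algebra_simps abs_le_iff)
  then have "a * (- (3 / 2 * d)) \<le> a * (x + s * y)" using a by (intro mult_left_mono) auto
  moreover have "a * d \<le> d / 2 * d" using a t by (intro mult_right_mono) auto
  moreover have "a\<^sup>2 \<le> (d / 2)\<^sup>2" using a by (intro power_mono) auto
  ultimately have "1 - 2 * d\<^sup>2 \<le> x\<^sup>2 + y\<^sup>2"
    using U(2) by (simp add: algebra_simps power2_eq_square)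
  then show ?thesis unfolding cap_def using le1 strip x_def y_def by simp
qed

lemma cap_disjoint_cball:
  assumes "0 < d" "d \<le> 1 / 10"
  shows "cap p d t \<inter> cball p d = {}"
proof -
  have "z \<notin> cball p d" if "z \<in> cap p d t" for z
  proof
    assume "z \<in> cball p d"
    then have "(dist z p)\<^sup>2 \<le> d\<^sup>2" by (intro power_mono) (auto simp: dist_commute)
    then have "(fst z - fst p)\<^sup>2 + (snd z - snd p)\<^sup>2 \<le> d\<^sup>2"
      by (simp add: dist_prod_def dist_real_def)
    then have "1 \<le> 3 * d\<^sup>2" using that unfolding cap_def by auto
    moreover have "d\<^sup>2 \<le> (1 / 10)\<^sup>2" using assms by (intro power_mono) auto
    ultimately show False by (simp add: power2_eq_square)
  qed
  then show ?thesis by auto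
qed

text \<open>The two pieces lie near the points where the line \<open>x + t y = 0\<close> meets the
  unit circle. As \<open>0 \<le> t \<le> 1\<close>, the rim there is far from vertical, so vertical
  sections are short: two intervals of length \<open>2 * d\<^sup>2\<close> each, over a set of
  abscissas of length at most \<open>40 * d\<close>.\<close>

lemma emeasure_cap_le:
  assumes d: "0 < d" "d \<le> 1 / 100" and t: "0 \<le> t" "t \<le> 1"
  shows "emeasure lborel (cap p d t) \<le> ennreal (160 * d ^ 3)"
proof -
  \<comment> \<open>The upper crossing point of the line and the unit circle is
    \<open>(- t * s, s)\<close>.\<close>
  define s where "s = 1 / sqrt (1 + t\<^sup>2)"
  have s2: "s\<^sup>2 * (1 + t\<^sup>2) = 1"
    unfolding s_def using add_pos_nonneg[of 1 "t\<^sup>2"] by (simp add: power_divide)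
  have t2: "t\<^sup>2 \<le> 1" using t by (simp add: power_le_one)
  have s0: "0 < s" unfolding s_def by (simp add: add_pos_nonneg)
  have s21: "s\<^sup>2 \<le> 1" using s2 mult_nonneg_nonneg[OF zero_le_power2[of s] zero_le_power2[of t]] unfolding distrib_left by linarith
  have "1 \<le> s\<^sup>2 * 2" using s2 t2 mult_left_mono[of "1 + t\<^sup>2" 2 "s\<^sup>2"] by simp
  then have "(7/10)\<^sup>2 \<le> s\<^sup>2" by (simp add: power2_eq_square)
  then have s7: "7 / 10 \<le> s" using s0 by (meson power2_le_imp_le less_imp_le)
  have dd: "d\<^sup>2 \<le> d / 10" using d mult_left_mono[of d "1/10" d] by (simp add: power2_eq_square)
  have upper: "\<bar>y - s\<bar> \<le> 7 * d \<and> \<bar>x + t * s\<bar> \<le> 10 * d"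
    if le: "x\<^sup>2 + y\<^sup>2 \<le> 1" and ge: "1 - 2 * d\<^sup>2 \<le> x\<^sup>2 + y\<^sup>2" and e: "\<bar>x + t * y\<bar> \<le> 2 * d" and "0 \<le> y" for x y
  proof -
    define e where "e = x + t * y"
    have x: "x = e - t * y" by (simp add: e_def)
    have "y\<^sup>2 \<le> 1" using le zero_le_power2[of x] by linarith
    then have y1: "y \<le> 1" using \<open>0 \<le> y\<close> by (simp add: power_le_one_iff)
    have e2: "e\<^sup>2 \<le> (2 * d)\<^sup>2" using e unfolding e_def by (intro abs_le_square_iff[THEN iffD1]) (use d in auto)
    have ety: "\<bar>e * t * y\<bar> \<le> 2 * d"
    proof -
      have "\<bar>e * t * y\<bar> = \<bar>e\<bar> * (t * y)" using t \<open>0 \<le> y\<close> by (simp add: abs_mult)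
      also have "\<dots> \<le> 2 * d * 1"
        using e t y1 \<open>0 \<le> y\<close> d unfolding e_def by (intro mult_mono mult_le_one) auto
      finally show ?thesis by simp
    qed
    \<comment> \<open>On the line and the circle themselves both sides vanish; the right side
      measures the deviation from each. It is at most \<open>4 * d + 6 * d\<^sup>2\<close>, hence
      \<open>46 / 10 * d\<close>, and dividing by \<open>y + s \<ge> 7 / 10\<close> yields the
      factor 7 below.\<close>
    have "(1 + t\<^sup>2) * y\<^sup>2 - 1 = (x\<^sup>2 + y\<^sup>2 - 1) + 2 * (e * t * y) - e\<^sup>2"
      unfolding x by (simp add: power2_eq_square algebra_simps)
    then have "\<bar>(1 + t\<^sup>2) * y\<^sup>2 - 1\<bar> \<le> 2 * d\<^sup>2 + 2 * (2 * d) + (2 * d)\<^sup>2"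
      using le ge ety e2 zero_le_power2[of e] unfolding abs_le_iff by linarith
    also have "\<dots> \<le> 46 / 10 * d" using dd by (simp add: power_mult_distrib)
    finally have b: "\<bar>(1 + t\<^sup>2) * y\<^sup>2 - 1\<bar> \<le> 46 / 10 * d" .
    have "s\<^sup>2 * ((1 + t\<^sup>2) * y\<^sup>2 - 1) = y\<^sup>2 - s\<^sup>2"
      using s2 by (simp add: right_diff_distrib flip: mult.assoc)
    also have "\<dots> = (y - s) * (y + s)" by (simp add: power2_eq_square algebra_simps)
    finally have "\<bar>y - s\<bar> * (y + s) = s\<^sup>2 * \<bar>(1 + t\<^sup>2) * y\<^sup>2 - 1\<bar>"
      using s0 \<open>0 \<le> y\<close> abs_mult[of "y - s" "y + s"] abs_mult[of "s\<^sup>2" "(1 + t\<^sup>2) * y\<^sup>2 - 1"] by simp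
    also have "\<dots> \<le> 46 / 10 * d" using b s21 d mult_mono[OF s21 b] by simp
    finally have "\<bar>y - s\<bar> * (y + s) \<le> 46 / 10 * d" .
    moreover have "\<bar>y - s\<bar> * (7 / 10) \<le> \<bar>y - s\<bar> * (y + s)" using s7 \<open>0 \<le> y\<close> by (intro mult_left_mono) auto
    ultimately have "\<bar>y - s\<bar> * (7 / 10) \<le> 46 / 10 * d" by (rule order_trans[rotated])
    then have ys: "\<bar>y - s\<bar> \<le> 7 * d" using d by simp
    have "\<bar>t * (y - s)\<bar> \<le> 7 * d"
      using ys t mult_mono[OF t(2) ys] by (simp add: abs_mult)
    moreover have "x + t * s = e - t * (y - s)" by (simp add: x algebra_simps)
    ultimately have "\<bar>x + t * s\<bar> \<le> 10 * d" using e unfolding e_def by linarith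
    with ys show ?thesis by blast
  qed
  define c where "c = t * s"
  define R where "R = {fst p - c - 10 * d .. fst p - c + 10 * d} \<union> {fst p + c - 10 * d .. fst p + c + 10 * d}"
  have main: "X \<in> R \<and> \<bar>\<bar>Y - snd p\<bar> - s\<bar> \<le> 7 * d" if "(X, Y) \<in> cap p d t" for X Y
  proof -
    let ?x = "X - fst p" and ?y = "Y - snd p"
    have *: "?x\<^sup>2 + ?y\<^sup>2 \<le> 1" "1 - 2 * d\<^sup>2 \<le> ?x\<^sup>2 + ?y\<^sup>2" "\<bar>?x + t * ?y\<bar> \<le> 2 * d"
      using that unfolding cap_def by auto
    show ?thesis
    proof (cases "0 \<le> ?y")
      case True
      with upper[OF * True] show ?thesis unfolding R_def c_def by (auto simp: abs_le_iff)
    next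
      \<comment> \<open>The cap is symmetric under reflection through \<open>p\<close>, so the lower
        piece reduces to the upper one.\<close>
      case False
      have "\<bar>- ?x + t * (- ?y)\<bar> \<le> 2 * d" using *(3) by (simp add: abs_minus_commute algebra_simps abs_le_iff)
      with upper[of "- ?x" "- ?y"] * False have "\<bar>- ?y - s\<bar> \<le> 7 * d \<and> \<bar>- ?x + t * s\<bar> \<le> 10 * d"
        by (simp only: power2_minus)
      with False show ?thesis unfolding R_def c_def by (auto simp: abs_le_iff)
    qed
  qed
  have "emeasure lborel (cap p d t) \<le> ennreal (4 * d\<^sup>2) * emeasure lborel R"
  proof (rule emeasure_lborel_le_sections)
    show "Pair X -` cap p d t = {}" if "X \<notin> R" for X using main that by auto
    show "emeasure lborel (Pair X -` cap p d t) \<le> ennreal (4 * d\<^sup>2)" for X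
    proof -
      \<comment> \<open>Height of the unit circle over \<open>X\<close>. Where the radicand is
        negative the section is empty, so the value of the root there is harmless.\<close>
      define r where "r = sqrt (1 - (X - fst p)\<^sup>2)"
      define V where "V = {snd p + r - 2 * d\<^sup>2 .. snd p + r}"
      define W where "W = {snd p - r .. snd p - r + 2 * d\<^sup>2}"
      have "Pair X -` cap p d t \<subseteq> V \<union> W"
      proof
        fix Y assume Y: "Y \<in> Pair X -` cap p d t"
        define y where "y = \<bar>Y - snd p\<bar>"
        have "\<bar>y - s\<bar> \<le> 7 * d" using main[of X Y] Y unfolding y_def by auto
        then have y: "1 / 2 \<le> y" using s7 d by linarith
        have y2: "y\<^sup>2 \<le> 1 - (X - fst p)\<^sup>2" "1 - (X - fst p)\<^sup>2 - 2 * d\<^sup>2 \<le> y\<^sup>2"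
          using Y unfolding cap_def y_def by auto
        then have "0 \<le> 1 - (X - fst p)\<^sup>2" using zero_le_power2[of y] by linarith
        then have r2: "r\<^sup>2 = 1 - (X - fst p)\<^sup>2" by (simp add: r_def)
        have yr: "y \<le> r" unfolding r_def using y2(1) by (rule real_le_rsqrt)
        \<comment> \<open>Since \<open>y \<ge> 1 / 2\<close>, also \<open>r + y \<ge> 1\<close>: the
          thickness \<open>2 * d\<^sup>2\<close> in squared radius is no larger when measured
          vertically.\<close>
        then have "(r - y) * 1 \<le> (r - y) * (r + y)" using y by (intro mult_left_mono) auto
        also have "\<dots> = r\<^sup>2 - y\<^sup>2" by (simp add: power2_eq_square algebra_simps)
        also have "\<dots> \<le> 2 * d\<^sup>2" using r2 y2 by simp
        finally have "r - 2 * d\<^sup>2 \<le> y" by simp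
        then show "Y \<in> V \<union> W" using yr unfolding y_def V_def W_def by auto
      qed
      then have "emeasure lborel (Pair X -` cap p d t) \<le> emeasure lborel (V \<union> W)"
        by (intro emeasure_mono) (auto simp: V_def W_def)
      also have "\<dots> \<le> emeasure lborel V + emeasure lborel W"
        by (rule emeasure_subadditive) (auto simp: V_def W_def)
      also have "\<dots> = ennreal (2 * d\<^sup>2) + ennreal (2 * d\<^sup>2)"
        unfolding V_def W_def by simp
      also have "\<dots> = ennreal (4 * d\<^sup>2)" by (simp flip: ennreal_plus)
      finally show ?thesis .
    qed
  qed (auto simp: R_def)
  also have "\<dots> \<le> ennreal (4 * d\<^sup>2) * ennreal (40 * d)"
  proof (rule mult_left_mono)
    have "emeasure lborel R \<le> emeasure lborel {fst p - c - 10 * d .. fst p - c + 10 * d}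
        + emeasure lborel {fst p + c - 10 * d .. fst p + c + 10 * d}"
      unfolding R_def by (rule emeasure_subadditive) auto
    also have "\<dots> = ennreal (20 * d) + ennreal (20 * d)" using d by simp
    also have "\<dots> = ennreal (40 * d)" using d by (simp flip: ennreal_plus)
    finally show "emeasure lborel R \<le> ennreal (40 * d)" .
  qed simp
  also have "\<dots> = ennreal (160 * d ^ 3)"
    using d by (simp flip: ennreal_mult add: power2_eq_square power3_eq_cube mult_ac)
  finally show ?thesis .
qed

subsection \<open>Uniform points in the disk\<close>

lemma disk_hat_borel: "disk_hat p \<in> sets borel"
proof -
  have "quadrant = {z. 0 \<le> fst z} \<inter> {z. 0 \<le> snd z}" by (auto simp: quadrant_def)
  also have "closed \<dots>" by (auto intro!: closed_Int closed_Collect_le continuous_intros)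
  finally have "closed (disk_hat p)" unfolding disk_hat_def by (intro closed_Int closed_cball)
  then show ?thesis by simp
qed

lemma emeasure_lborel_rectangle:
  fixes a b c d :: real
  assumes "a \<le> b" "c \<le> d"
  shows "emeasure lborel ({a..b} \<times> {c..d}) = ennreal ((b - a) * (d - c))"
proof -
  have "emeasure lborel ({a..b} \<times> {c..d}) = emeasure (lborel \<Otimes>\<^sub>M lborel) ({a..b} \<times> {c..d})"
    by (simp add: lborel_prod)
  also have "\<dots> = emeasure lborel {a..b} * emeasure lborel {c..d}"
    by (rule lborel.emeasure_pair_measure_Times) auto
  finally show ?thesis using assms by (simp add: ennreal_mult)
qed

text \<open>Crude bounds uniform in \<open>p\<close>: the square of side \<open>1 / 2\<close> with
  lower left corner \<open>p\<close> is never cut off by the axes, and a square of side 2 contains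
  the disk. They convert areas into probabilities.\<close>

lemma emeasure_disk_hat:
  assumes "0 \<le> fst p" "0 \<le> snd p"
  shows "ennreal (1 / 4) \<le> emeasure lborel (disk_hat p)" "emeasure lborel (disk_hat p) \<le> ennreal 4"
proof -
  let ?Q = "{fst p .. fst p + 1 / 2} \<times> {snd p .. snd p + 1 / 2}"
  let ?R = "{fst p - 1 .. fst p + 1} \<times> {snd p - 1 .. snd p + 1}"
  have "?Q \<subseteq> disk_hat p"
  proof
    fix z assume z: "z \<in> ?Q"
    then have "(fst z - fst p)\<^sup>2 + (snd z - snd p)\<^sup>2 \<le> (1 / 2)\<^sup>2 + (1 / 2)\<^sup>2"
      by (intro add_mono power_mono) auto
    then have "sqrt ((fst z - fst p)\<^sup>2 + (snd z - snd p)\<^sup>2) \<le> 1"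
      by (simp add: power2_eq_square)
    then have "dist z p \<le> 1" by (simp add: dist_prod_def dist_real_def)
    then show "z \<in> disk_hat p"
      using z assms by (auto simp: disk_hat_def quadrant_def dist_commute case_prod_beta)
  qed
  then have "emeasure lborel ?Q \<le> emeasure lborel (disk_hat p)"
    using disk_hat_borel by (intro emeasure_mono) auto
  then show "ennreal (1 / 4) \<le> emeasure lborel (disk_hat p)"
    by (simp add: emeasure_lborel_rectangle)
  have "disk_hat p \<subseteq> ?R"
  proof
    fix z assume "z \<in> disk_hat p"
    then have z: "dist p z \<le> 1" by (simp add: disk_hat_def)
    have "\<bar>fst p - fst z\<bar> \<le> 1" "\<bar>snd p - snd z\<bar> \<le> 1"
      using order_trans[OF dist_fst_le z] order_trans[OF dist_snd_le z] by (auto simp: dist_real_def)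
    then show "z \<in> ?R" by (auto simp: mem_Times_iff abs_le_iff)
  qed
  moreover have "?R \<in> sets lborel"
    by (simp add: borel_Times)
  ultimately have "emeasure lborel (disk_hat p) \<le> emeasure lborel ?R"
    by (rule emeasure_mono)
  then show "emeasure lborel (disk_hat p) \<le> ennreal 4"
    by (simp add: emeasure_lborel_rectangle)
qed

section \<open>From geometry to a bound on the failure probability\<close>

text \<open>The two subtracted terms are the chance that no pair of opposite sectors is hit and the
  chance that some point falls in the cap of the first pair hit. The number \<open>q\<close> is a
  sector's area bound divided by the maximal disk area 4, and \<open>640 = 160 / (1 / 4)\<close>
  uses the minimal area.\<close>

lemma prob_connected_dominating_pair:
  fixes p :: "real \<times> real" and d :: real and k m w b :: nat
  assumes d: "0 < d" "d \<le> 1 / 100" and p: "d \<le> fst p" "d \<le> snd p"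
    and k: "0 < k" "1 / real k \<le> d" and m: "0 < m" "2 * m \<le> b"
  defines "q \<equiv> (1 / real k) * (d / 4)\<^sup>2 / 4"
  shows "1 - 1 / (real k * (1 - (1 - q) ^ m)\<^sup>2) - real (w + b) * (640 * d ^ 3)
    \<le> measure (uniform_points (w + b) p)
        {X \<in> space (uniform_points (w + b) p).
          \<exists>u\<in>blue w b. \<exists>v\<in>blue w b. u \<noteq> v \<and>
            X u \<in> cball p d \<and> X v \<in> cball p d \<and>
            connected_dominating_set (with_proj (unit_disk_graph (w + b) X)) {u, v}}"
    (is "_ \<le> measure _ ?G")
proof -
  define n where "n = w + b"
  define D where "D = disk_hat p"
  define M where "M = uniform_measure lborel D"
  define P where "P = PiM {..<n} (\<lambda>_. M)"
  have P: "uniform_points (w + b) p = P"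
    by (simp add: uniform_points_def P_def M_def D_def n_def)
  have DB[measurable]: "D \<in> sets borel" unfolding D_def by (rule disk_hat_borel)
  have eD: "ennreal (1 / 4) \<le> emeasure lborel D" "emeasure lborel D \<le> ennreal 4"
    unfolding D_def using emeasure_disk_hat p d by auto
  have D0: "emeasure lborel D \<noteq> 0" using eD(1) by (auto simp: ennreal_eq_0_iff)
  have D1: "emeasure lborel D \<noteq> \<infinity>" using eD(2) by (auto simp: top_unique)
  have Dm: "1 / 4 \<le> measure lborel D" "measure lborel D \<le> 4"
    using eD D1 by (auto simp: emeasure_eq_ennreal_measure simp del: ennreal_numeral)
  have M: "prob_space M" unfolding M_def using D0 D1 by (rule prob_space_uniform_measure)
  have setsM: "sets M = sets borel" and spaceM: "space M = UNIV"
    by (auto simp: M_def)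
  interpret M: prob_space M by (rule M)
  interpret PP: product_prob_space "\<lambda>_. M" "{..<n}" by standard
  interpret P: prob_space P unfolding P_def by (rule PP.P.prob_space_axioms)
  have meas: "measure M B = measure lborel (D \<inter> B) / measure lborel D" if "B \<in> sets borel" for B
    unfolding M_def using D0 D1 that by simp
  \<comment> \<open>The distance of \<open>p\<close> from both axes enters here: the small disk is
    not truncated.\<close>
  have DD: "cball p d \<subseteq> D"
  proof
    fix z assume z: "z \<in> cball p d"
    then have zd: "dist p z \<le> d" by simp
    have "\<bar>fst p - fst z\<bar> \<le> d" "\<bar>snd p - snd z\<bar> \<le> d"
      using order_trans[OF dist_fst_le zd] order_trans[OF dist_snd_le zd] by (auto simp: dist_real_def)
    then show "z \<in> D" using p zd d by (cases z) (auto simp: D_def disk_hat_def quadrant_def)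
  qed
  define h where "h = 1 / real k"
  \<comment> \<open>The slopes \<open>j * h\<close> with \<open>j < k\<close> and
    \<open>h = 1 / k\<close> divide the range from 0 to 1.\<close>
  define S where "S j = sector p 1 (d / 4) h (real j * h)" for j :: nat
  define T where "T j = sector p (-1) (d / 4) h (real j * h)" for j :: nat
  \<comment> \<open>Sample points lie in \<open>D\<close> only almost surely. Adding the null set
    \<open>- D\<close> to the cap absorbs the exceptions at no cost, and it stays disjoint from the
    sectors because they lie in \<open>D\<close>.\<close>
  define U where "U j = cap p d (real j * h) \<union> (- D)" for j :: nat
  define A where "A = {w..<w + m}"
  define B where "B = {w + m..<w + 2 * m}"
  have AB: "A \<subseteq> {..<n}" "B \<subseteq> {..<n}" "A \<inter> B = {}" "card A = m" "card B = m"
    "A \<subseteq> blue w b" "B \<subseteq> blue w b"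
    using m by (auto simp: A_def B_def n_def blue_def)
  have h: "0 < h" "h \<le> d" using k by (auto simp: h_def)
  have jh: "0 \<le> real j * h" "real j * h + h \<le> 1" if "j < k" for j
  proof -
    have "real j * h + h = real (Suc j) / real k" by (simp add: h_def add_divide_distrib)
    then show "real j * h + h \<le> 1" using that by (simp del: of_nat_Suc)
  qed (use h in auto)
  have sub: "S j \<subseteq> cball p d" "T j \<subseteq> cball p d" if "j < k" for j
    using sector_subset_cball[OF jh[OF that], of "d / 4" _ p] d unfolding S_def T_def by auto
  have sets: "S j \<in> sets M" "T j \<in> sets M" "U j \<in> sets M" for j
    unfolding setsM S_def T_def U_def by auto
  have ge: "q \<le> measure M V"
    if "V \<in> sets borel" "ennreal (h * (d / 4)\<^sup>2) \<le> emeasure lborel V" "V \<subseteq> cball p d" for V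
  proof -
    have "D \<inter> V = V" using that DD by auto
    have "emeasure lborel V \<le> emeasure lborel D" using that DD by (intro emeasure_mono) auto
    then have "emeasure lborel V \<noteq> \<infinity>" using D1 by (auto simp: top_unique)
    then have "h * (d / 4)\<^sup>2 \<le> measure lborel V"
      using that(2) by (auto simp: emeasure_eq_ennreal_measure)
    moreover have "measure M V = measure lborel V / measure lborel D"
      using meas[OF that(1)] \<open>D \<inter> V = V\<close> by simp
    moreover have "h * (d / 4)\<^sup>2 / 4 \<le> measure lborel V / measure lborel D"
      using Dm h calculation by (intro frac_le) auto
    ultimately show ?thesis unfolding q_def h_def[symmetric] by simp
  qed
  have Uq: "measure M (U j) \<le> 640 * d ^ 3" if "j < k" for j
  proof -
    let ?C = "cap p d (real j * h)"
    have "emeasure lborel ?C \<le> ennreal (160 * d ^ 3)"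
      using emeasure_cap_le[OF d jh(1)[OF that]] jh(2)[OF that] h by simp
    moreover have "emeasure lborel (D \<inter> U j) \<le> emeasure lborel ?C"
      by (intro emeasure_mono) (auto simp: U_def)
    ultimately have "emeasure lborel (D \<inter> U j) \<le> ennreal (160 * d ^ 3)" by (rule order_trans[rotated])
    then have "measure lborel (D \<inter> U j) \<le> 160 * d ^ 3"
      using d by (auto simp: measure_def enn2real_leI)
    then have "measure lborel (D \<inter> U j) / measure lborel D \<le> 160 * d ^ 3 / (1 / 4)"
      using Dm d by (intro frac_le) auto
    then show ?thesis using meas[of "U j"] sets(3)[of j] setsM by simp
  qed
  define N where "N = {X \<in> space P. \<forall>j<k. \<not> ((\<exists>i\<in>A. X i \<in> S j) \<and> (\<exists>i\<in>B. X i \<in> T j))}"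
  define F where "F = {X \<in> space P. \<exists>i\<in>{..<n}. \<exists>j<k. ((\<exists>i\<in>A. X i \<in> S j) \<and> (\<exists>i\<in>B. X i \<in> T j)) \<and>
      (\<forall>l<j. \<not> ((\<exists>i\<in>A. X i \<in> S l) \<and> (\<exists>i\<in>B. X i \<in> T l))) \<and> X i \<in> U j}"
  have N: "measure P N \<le> 1 / (real k * (1 - (1 - q) ^ m)\<^sup>2)" "N \<in> sets P"
  proof -
    have S': "S j \<inter> S l = {}" "T j \<inter> T l = {}" if "j \<noteq> l" for j l
      using sector_disjoint[OF _ h(1) that, of "d / 4" p] d unfolding S_def T_def by auto
    have q': "q \<le> measure M (S j)" "q \<le> measure M (T j)" if "j < k" for j
      using ge[of "S j"] ge[of "T j"] sub[OF that] sets[of j] setsM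
        emeasure_sector_ge[of "d / 4" h 1 p "real j * h"] emeasure_sector_ge[of "d / 4" h "-1" p "real j * h"] d h
      unfolding S_def T_def by auto
    have "0 < q" using d k by (simp add: q_def)
    note * = prob_PiM_no_double_hit[OF M _ AB(1-5) m(1) sets(1) S'(1) q'(1) sets(2) S'(2) q'(2) this k(1)]
    show "measure P N \<le> 1 / (real k * (1 - (1 - q) ^ m)\<^sup>2)" "N \<in> sets P"
      unfolding N_def P_def by (rule *; simp)+
  qed
  have F: "measure P F \<le> real n * (640 * d ^ 3)" "F \<in> sets P"
  proof -
    have disj: "U j \<inter> (S l \<union> T l) = {}" if "j < k" "l < k" for j l
      using sub[OF that(2)] cap_disjoint_cball[of d p "real j * h"] d DD unfolding U_def by auto
    have "0 \<le> 640 * d ^ 3" using d by simp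
    note * = prob_PiM_first_double_hit[OF M _ AB(1,2) sets(1,2,3) Uq this disj]
    show "measure P F \<le> real n * (640 * d ^ 3)"
      unfolding F_def P_def by (rule order_trans[OF *(1)]) auto
    show "F \<in> sets P" unfolding F_def P_def by (rule *(2)) auto
  qed
  have iff: "connected_dominating_set (with_proj (unit_disk_graph (w + b) X)) {u, v} \<longleftrightarrow>
      dist (X u) (X v) \<le> 1 \<and> (\<forall>i<n. dist (X i) (X u) \<le> 1 \<or> dist (X i) (X v) \<le> 1)"
    if "u \<in> blue w b" "v \<in> blue w b" "u \<noteq> v" for u v X
    using that connected_dominating_pair_iff[of u "w + b" v X] by (auto simp: blue_def n_def)
  define G where "G = ?G"
  \<comment> \<open>Graph domination is rewritten through distances, which makes measurability of
    the good event accessible.\<close>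
  define Q where "Q u v X \<longleftrightarrow> X u \<in> cball p d \<and> X v \<in> cball p d \<and> dist (X u) (X v) \<le> 1 \<and>
      (\<forall>i\<in>{..<n}. dist (X i) (X u) \<le> 1 \<or> dist (X i) (X v) \<le> 1)" for u v X
  have "(\<exists>u\<in>blue w b. \<exists>v\<in>blue w b. u \<noteq> v \<and> X u \<in> cball p d \<and> X v \<in> cball p d \<and>
          connected_dominating_set (with_proj (unit_disk_graph (w + b) X)) {u, v})
      \<longleftrightarrow> (\<exists>u\<in>blue w b. \<exists>v\<in>blue w b. u \<noteq> v \<and> Q u v X)" for X
    by (intro bex_cong refl conj_cong) (simp_all add: iff Q_def Ball_def)
  then have G_eq: "G = {X \<in> space P. \<exists>u\<in>blue w b. \<exists>v\<in>blue w b. u \<noteq> v \<and> Q u v X}"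
    unfolding G_def P by (simp only:)
  have G: "G \<in> sets P"
  proof -
    have comp: "(\<lambda>X. X i) \<in> borel_measurable P" if "i < n" for i
    proof -
      have "(\<lambda>X. X i) \<in> measurable P M" unfolding P_def using that by (intro measurable_component_singleton) simp
      then show ?thesis by (simp cong: measurable_cong_sets add: setsM)
    qed
    have "{X \<in> space P. Q u v X} \<in> sets P" if "u < n" "v < n" for u v
    proof -
      note [measurable] = comp[OF that(1)] comp[OF that(2)]
      have "Measurable.pred P (\<lambda>X. \<forall>i\<in>{..<n}. dist (X i) (X u) \<le> 1 \<or> dist (X i) (X v) \<le> 1)"
      proof (intro pred_intros_finite)
        fix i assume "i \<in> {..<n}"
        then have [measurable]: "(\<lambda>X. X i) \<in> borel_measurable P" using comp by simp
        show "Measurable.pred P (\<lambda>X. dist (X i) (X u) \<le> 1 \<or> dist (X i) (X v) \<le> 1)" by measurable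
      qed simp
      note [measurable] = this
      show ?thesis unfolding Q_def mem_cball by measurable
    qed
    then have "(\<Union>u\<in>blue w b. \<Union>v\<in>{v \<in> blue w b. u \<noteq> v}. {X \<in> space P. Q u v X}) \<in> sets P"
      by (intro sets.finite_UN) (auto simp: blue_def n_def)
    also have "(\<Union>u\<in>blue w b. \<Union>v\<in>{v \<in> blue w b. u \<noteq> v}. {X \<in> space P. Q u v X}) = G"
      unfolding G_eq by (rule set_eqI) (simp only: UN_iff mem_Collect_eq Bex_def; fast)
    finally show ?thesis .
  qed
  \<comment> \<open>If some pair is hit, two blue points witness the first one. When they fail to
    dominate, an uncovered point exists and lies in the cap of that pair or outside
    \<open>D\<close>.\<close>
  have "space P - G \<subseteq> N \<union> F"
  proof
    fix X assume X: "X \<in> space P - G"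
    let ?E = "\<lambda>j. (\<exists>i\<in>A. X i \<in> S j) \<and> (\<exists>i\<in>B. X i \<in> T j)"
    show "X \<in> N \<union> F"
    proof (cases "\<exists>j<k. ?E j")
      case False
      then show ?thesis using X by (auto simp: N_def)
    next
      case True
      define j where "j = (LEAST j. ?E j)"
      obtain j0 where j0: "j0 < k" "?E j0" using True by blast
      have E: "?E j" unfolding j_def using j0(2) by (rule LeastI)
      have first: "\<not> ?E l" if "l < j" for l using not_less_Least that unfolding j_def by blast
      have "j \<le> j0" unfolding j_def using j0(2) by (rule Least_le)
      then have jk: "j < k" using j0 by simp
      obtain u v where uv: "u \<in> A" "X u \<in> S j" "v \<in> B" "X v \<in> T j" using E by blast
      have "u \<noteq> v" using uv AB by auto
      have ub: "u \<in> blue w b" "v \<in> blue w b" using uv AB by auto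
      have c: "X u \<in> cball p d" "X v \<in> cball p d" using uv sub[OF jk] by auto
      then have "dist (X u) (X v) \<le> 1"
        using dist_triangle[of "X u" "X v" p] d by (simp add: dist_commute)
      moreover have not_Q: "\<not> Q u v X" using X ub \<open>u \<noteq> v\<close> unfolding G_eq by auto
      ultimately obtain i where i: "i < n" "1 < dist (X i) (X u)" "1 < dist (X i) (X v)"
        using not_Q c unfolding Q_def by (auto simp: not_le)
      have "X i \<in> U j"
      proof (cases "X i \<in> D")
        case True
        then have "dist (X i) p \<le> 1" by (simp add: D_def disk_hat_def dist_commute)
        then show ?thesis
          unfolding U_def using uncovered_subset_cap[OF uv(2,4)[unfolded S_def T_def] jh[OF jk] h(2) d(1) _ i(2,3)]
          by simp
      qed (simp add: U_def)
      then show ?thesis using X i E first jk unfolding F_def by blast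
    qed
  qed
  then have "measure P (space P - G) \<le> measure P (N \<union> F)"
    using N F by (intro P.finite_measure_mono) auto
  also have "\<dots> \<le> measure P N + measure P F"
    using N F by (intro measure_Un_le) auto
  finally have "1 - measure P G \<le> 1 / (real k * (1 - (1 - q) ^ m)\<^sup>2) + real n * (640 * d ^ 3)"
    using P.prob_compl[OF G] N(1) F(1) by linarith
  then show ?thesis unfolding G_def P n_def by linarith
qed

section \<open>Numerical estimates and the choice of parameters\<close>

text \<open>From \<open>(1 - q) ^ m * (1 + q) ^ m \<le> 1\<close> and Bernoulli's inequality,
  \<open>(1 - q) ^ m \<le> 1 / (1 + y)\<close>; finally \<open>y / (1 + y) \<ge> y / 2\<close>
  because \<open>y \<le> 1\<close>.\<close>

lemma one_minus_power_ge:
  fixes q y :: real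
  assumes "0 \<le> q" "q \<le> 1" "0 \<le> y" "y \<le> 1" "y \<le> real m * q"
  shows "y / 2 \<le> 1 - (1 - q) ^ m"
proof -
  have "1 + y \<le> 1 + real m * q" using assms by simp
  also have "\<dots> \<le> (1 + q) ^ m" using assms by (intro Bernoulli_inequality) auto
  finally have "(1 - q) ^ m * (1 + y) \<le> (1 - q) ^ m * (1 + q) ^ m"
    using assms by (intro mult_left_mono) auto
  also have "\<dots> = (1 - q\<^sup>2) ^ m"
    by (simp add: power_mult_distrib[symmetric] power2_eq_square algebra_simps)
  also have "\<dots> \<le> 1" using assms by (intro power_le_one) (auto simp: power_le_one)
  finally have "(1 - q) ^ m \<le> 1 / (1 + y)" using assms by (simp add: field_simps)
  moreover have "y / 2 \<le> 1 - 1 / (1 + y)" using assms by (simp add: field_simps) (metis mult_left_le)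
  ultimately show ?thesis by linarith
qed


text \<open>With \<open>L = ln b\<close>, the Chebyshev term is of order
  \<open>L ^ 6 * delta b = L ^ 5 / b powr (1/3)\<close>. Comparing it with
  \<open>1 / L powr (3/2)\<close> leads to the exponent \<open>13/2 = 5 + 3/2\<close>.\<close>

lemma eventually_delta_small:
  "eventually (\<lambda>b::nat. 1 \<le> ln (real b) \<and> delta b \<le> 1 / 100 \<and>
     ln (real b) powr (13/2) \<le> real b powr (1/3)) sequentially"
proof (intro eventually_conj)
  show "eventually (\<lambda>b::nat. 1 \<le> ln (real b)) sequentially" by real_asymp
  show "eventually (\<lambda>b::nat. delta b \<le> 1 / 100) sequentially" unfolding delta_def by real_asymp
  show "eventually (\<lambda>b::nat. ln (real b) powr (13/2) \<le> real b powr (1/3)) sequentially" by real_asymp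
qed

lemma failure_bound:
  fixes b w :: nat
  assumes b: "2 \<le> b" and L1: "1 \<le> ln (real b)" and d1: "delta b \<le> 1 / 100"
    and big: "ln (real b) powr (13/2) \<le> real b powr (1/3)"
    and w: "real w < real b * ln (real b) powr (3/2)"
  defines "k \<equiv> nat \<lceil>1 / delta b\<rceil>" and "m \<equiv> b div 2"
  defines "q \<equiv> (1 / real k) * (delta b / 4)\<^sup>2 / 4"
  shows "0 < k" "1 / real k \<le> delta b"
    and "1 / (real k * (1 - (1 - q) ^ m)\<^sup>2) + real (w + b) * (640 * delta b ^ 3)
      \<le> 600000 / ln (real b) powr (3/2)"
proof -
  define L where "L = ln (real b)"
  define d where "d = delta b"
  have d: "d = 1 / (real b powr (1/3) * L)" by (simp add: d_def delta_def L_def)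
  have L: "1 \<le> L" using L1 by (simp add: L_def)
  have b0: "0 < real b" using b by simp
  have d0: "0 < d" unfolding d using L b0 by simp
  have dle: "d \<le> 1 / 100" using d1 by (simp add: d_def)
  have d3: "d ^ 3 = 1 / (real b * L ^ 3)"
    using b0 by (simp add: d power_divide power_mult_distrib powr_realpow[symmetric] powr_powr)
  have kd: "1 / d \<le> real k" unfolding k_def d_def by linarith
  show k0: "0 < k" using kd d0 by (smt (verit) of_nat_0_less_iff zero_less_divide_1_iff)
  show kle: "1 / real k \<le> delta b"
    using kd d0 k0 unfolding d_def[symmetric] by (simp add: field_simps)
  have "real k \<le> 1 / d + 1" unfolding k_def d_def[symmetric] using d0 of_int_ceiling_le_add_one[of "1 / d"] by simp
  also have "\<dots> \<le> 2 / d" using d0 dle by (simp add: field_simps)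
  finally have h: "d / 2 \<le> 1 / real k" using d0 k0 by (simp add: field_simps)
  \<comment> \<open>Rounding \<open>1 / d\<close> up at most doubles it, so
    \<open>1 / k \<ge> d / 2\<close>, and \<open>128 = 2 * 16 * 4\<close>.\<close>
  have q_ge: "d ^ 3 / 128 \<le> q"
    using mult_right_mono[OF h, of "(d / 4)\<^sup>2 / 4"] unfolding q_def d_def[symmetric]
    by (simp add: power2_eq_square power3_eq_cube)
  have "(d / 4)\<^sup>2 \<le> 1" using d0 dle by (intro power_le_one) auto
  moreover have "1 / real k \<le> 1" using k0 by simp
  ultimately have "1 / real k * (d / 4)\<^sup>2 \<le> 1" by (intro mult_le_one) auto
  then have q01: "0 \<le> q" "q \<le> 1" unfolding q_def d_def[symmetric] by auto
  \<comment> \<open>A lower bound for the expected number \<open>m * q\<close> of hits: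
    \<open>m \<ge> b / 3\<close> and \<open>q \<ge> d ^ 3 / 128\<close>, with
    \<open>b * d ^ 3 = 1 / L ^ 3\<close> and \<open>384 = 3 * 128\<close>.\<close>
  define y where "y = 1 / (384 * L ^ 3)"
  have "1 \<le> 384 * L ^ 3" using one_le_power[OF L, of 3] by linarith
  then have y: "0 < y" "y \<le> 1" using L by (auto simp: y_def)
  have "b \<le> 3 * m" using b unfolding m_def by linarith
  then have mb: "real b / 3 \<le> real m" by linarith
  have "y = real b / 3 * (d ^ 3 / 128)" using b0 by (simp add: y_def d3)
  also have "\<dots> \<le> real m * q" using mb q_ge d0 by (intro mult_mono) auto
  finally have "y / 2 \<le> 1 - (1 - q) ^ m" using y q01 by (intro one_minus_power_ge) auto
  then have "(y / 2)\<^sup>2 \<le> (1 - (1 - q) ^ m)\<^sup>2" using y by (intro power_mono) auto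
  then have "1 / d * (y / 2)\<^sup>2 \<le> real k * (1 - (1 - q) ^ m)\<^sup>2"
    using kd by (intro mult_mono) auto
  then have "1 / (real k * (1 - (1 - q) ^ m)\<^sup>2) \<le> 1 / (1 / d * (y / 2)\<^sup>2)"
    using d0 y by (intro frac_le) auto
  \<comment> \<open>The constant is \<open>(2 * 384)\<^sup>2\<close>.\<close>
  also have "\<dots> = 589824 * L ^ 6 * d"
    using d0 by (simp add: y_def power2_eq_square power_mult_distrib field_simps eval_nat_numeral)
  also have "\<dots> \<le> 589824 / L powr (3/2)"
  proof -
    have "L ^ 5 * L powr (3/2) = L powr (13/2)"
      using L powr_add[of L 5 "3/2"] by simp
    then have "L ^ 5 * L powr (3/2) \<le> real b powr (1/3)" using big by (simp add: L_def)
    moreover have "L ^ 6 * d = L ^ 5 / real b powr (1/3)"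
      unfolding d using L by (simp add: eval_nat_numeral)
    ultimately have "L ^ 6 * d * L powr (3/2) \<le> 1" using b0 by (simp add: divide_le_eq)
    then have "L ^ 6 * d \<le> 1 / L powr (3/2)" using L by (simp add: le_divide_eq)
    then show ?thesis by simp
  qed
  finally have 1: "1 / (real k * (1 - (1 - q) ^ m)\<^sup>2) \<le> 589824 / L powr (3/2)" .
  have "1 \<le> L powr (3/2)" using L by (simp add: ge_one_powr_ge_zero)
  then have "real b * 1 \<le> real b * L powr (3/2)" by (intro mult_left_mono) auto
  then have "real (w + b) \<le> 2 * real b * L powr (3/2)" using w by (simp add: L_def)
  then have "real (w + b) * (640 * d ^ 3) \<le> 2 * real b * L powr (3/2) * (640 * d ^ 3)"
    using d0 by (intro mult_right_mono) auto
  also have "\<dots> = 1280 * (L powr (3/2) / L ^ 3)" using b0 by (simp add: d3)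
  also have "L ^ 3 = L powr (3/2) * L powr (3/2)"
    using L powr_add[of L "3/2" "3/2"] by simp
  also have "1280 * (L powr (3/2) / (L powr (3/2) * L powr (3/2))) = 1280 / L powr (3/2)"
    using L by simp
  finally have 2: "real (w + b) * (640 * d ^ 3) \<le> 1280 / L powr (3/2)" .
  have "589824 / L powr (3/2) + 1280 / L powr (3/2) \<le> 600000 / L powr (3/2)"
    using L by (simp add: field_simps)
  then show "1 / (real k * (1 - (1 - q) ^ m)\<^sup>2) + real (w + b) * (640 * delta b ^ 3)
      \<le> 600000 / ln (real b) powr (3/2)"
    using 1 2 unfolding L_def[symmetric] d_def[symmetric] by linarith
qed

theorem theorem4:
  shows "\<exists>c>0. \<forall>(b::nat) (w::nat) (p::real \<times> real).
    2 \<le> b \<longrightarrow> 0 < w \<longrightarrow> real w < real b * ln (real b) powr (3/2) \<longrightarrow>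
    delta b \<le> fst p \<longrightarrow> delta b \<le> snd p \<longrightarrow>
      measure (uniform_points (w + b) p)
        {X \<in> space (uniform_points (w + b) p).
          \<exists>u\<in>blue w b. \<exists>v\<in>blue w b. u \<noteq> v \<and>
            X u \<in> cball p (delta b) \<and> X v \<in> cball p (delta b) \<and>
            connected_dominating_set (with_proj (unit_disk_graph (w + b) X)) {u, v}}
      \<ge> 1 - c / ln (real b) powr (3/2)"
proof -
  obtain b0 :: nat where b0: "\<And>b. b0 \<le> b \<Longrightarrow> 1 \<le> ln (real b) \<and> delta b \<le> 1 / 100 \<and>
      ln (real b) powr (13/2) \<le> real b powr (1/3)"
    using eventually_delta_small unfolding eventually_sequentially by blast
  \<comment> \<open>The second entry of the maximum makes the claimed lower bound at most 0 for
    every \<open>b < b0\<close>, so small \<open>b\<close> need no argument.\<close>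
  define c where "c = max 600000 (ln (real b0) powr (3/2))"
  show ?thesis
  proof (intro exI[of _ c] conjI allI impI)
    show "0 < c" by (simp add: c_def)
    fix b w :: nat and p :: "real \<times> real"
    assume b: "2 \<le> b" and "0 < w" and w: "real w < real b * ln (real b) powr (3/2)"
      and p: "delta b \<le> fst p" "delta b \<le> snd p"
    let ?G = "{X \<in> space (uniform_points (w + b) p).
          \<exists>u\<in>blue w b. \<exists>v\<in>blue w b. u \<noteq> v \<and>
            X u \<in> cball p (delta b) \<and> X v \<in> cball p (delta b) \<and>
            connected_dominating_set (with_proj (unit_disk_graph (w + b) X)) {u, v}}"
    have L: "0 < ln (real b)" using b by simp
    show "1 - c / ln (real b) powr (3/2) \<le> measure (uniform_points (w + b) p) ?G"
    proof (cases "b0 \<le> b")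
      case True
      note big = b0[OF True, THEN conjunct1] b0[OF True, THEN conjunct2, THEN conjunct1]
        b0[OF True, THEN conjunct2, THEN conjunct2]
      note bound = failure_bound[OF b big w]
      have d0: "0 < delta b" using L b by (simp add: delta_def)
      have m: "0 < b div 2" "2 * (b div 2) \<le> b" using b by auto
      have "600000 / ln (real b) powr (3/2) \<le> c / ln (real b) powr (3/2)"
        by (intro divide_right_mono) (auto simp: c_def)
      moreover have "1 - c' \<le> g" if "1 - x - y \<le> g" "x + y \<le> z" "z \<le> c'" for x y z c' g :: real
        using that by linarith
      ultimately show ?thesis
        using prob_connected_dominating_pair[OF d0 big(2) p bound(1,2) m, of w] bound(3) by blast
    next
      case False
      then have "ln (real b) powr (3/2) \<le> ln (real b0) powr (3/2)"
        using b L by (intro powr_mono2) auto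
      then have "ln (real b) powr (3/2) \<le> c" by (simp add: c_def)
      then have "1 - c / ln (real b) powr (3/2) \<le> 0" using L by (simp add: field_simps)
      then show ?thesis by (rule order_trans) simp
    qed
  qed
qed

end
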